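(* For any nonlocal vertex algebra $V$, $B(V)$ is a $\Delta$-closed associative subalgebra of $\mathrm{Hom}(V,V\otimes\mathbb{C}((x)))$ and it is closed under the derivation $\partial=\frac{d}{dx}$. Furthermore, $V$ is a module for the nonlocal vertex algebra $(B(V),\partial)$ with $Y_V(a(x),x_0)=a(x_0)$ for $a(x)\in B(V)$.
   Context: All vector spaces are over $\mathbb{C}$; $(x_1\pm x_2)^n$ is expanded in nonnegative powers of the second variable. A nonlocal vertex algebra is a vector space $V$ with a linear map $Y(\cdot,x):V\to\mathrm{Hom}(V,V((x)))$, $v\mapsto Y(v,x)=\sum_{n\in\mathbb{Z}}v_nx^{-n-1}$, and a vacuum vector $\mathbf{1}\in V$ such that $Y(\mathbf{1},x)=1$; $Y(v,x)\mathbf{1}\in V[[x]]$ with $\lim_{x\to0}Y(v,x)\mathbf{1}=v$; and for all $u,v,w\in V$ there is a nonnegative integer $l$ with $(x_0+x_2)^lY(u,x_0+x_2)Y(v,x_2)w=(x_0+x_2)^lY(Y(u,x_0)v,x_2)w$. A module for $V$ is a vector space $W$ with a linear map $Y_W:V\to\mathrm{Hom}(W,W((x)))$ such that $Y_W(\mathbf{1},x)=1_W$ and for all $u,v\in V$, $w\in W$ there is $l\ge0$ with $(x_0+x_2)^lY_W(u,x_0+x_2)Y_W(v,x_2)w=(x_0+x_2)^lY_W(Y(u,x_0)v,x_2)w$. For a unital associative algebra $A$ with a derivation $\partial$, $(A,\partial)$ denotes the nonlocal vertex algebra on $A$ with vacuum $1$ and $Y(a,x)b=(e^{x\partial}a)b$.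 $\mathrm{Hom}_{\mathbb{C}}(V,V\otimes\mathbb{C}((x)))$ is identified with $\mathrm{End}_{\mathbb{C}((x))}(V\otimes\mathbb{C}((x)))$, an associative algebra with the $\mathbb{C}$-linear derivation $\partial=d/dx$; its elements are written $a(x)$. $Y$ is extended linearly over scalar Laurent series. A subset $U$ of it is $\Delta$-closed if for any $a(x)\in U$ there exist $a_{(1i)}(x),a_{(2i)}(x)\in U$, $i=1,\dots,r$, with $a(x_1)Y(v,x_2)=\sum_{i=1}^rY(a_{(1i)}(x_1-x_2)v,x_2)a_{(2i)}(x_1)$ for all $v\in V$. $B(V)$ is the sum of all $\Delta$-closed subspaces $U$ of $\mathrm{Hom}(V,V\otimes\mathbb{C}((x)))$ such that $a(x)\mathbf{1}\in\mathbb{C}\mathbf{1}$ for all $a(x)\in U$. *)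

theory Defs
  imports
    "HOL-Library.Function_Algebras"
    "HOL-Library.Groups_Big_Fun"
    "HOL-Computational_Algebra.Formal_Laurent_Series"
begin

unbundle fps_syntax

text \<open>
  A complex vector space is a type of class \<^class>\<open>ab_group_add\<close> with a scalar
  multiplication satisfying \<^locale>\<open>vector_space\<close>, and possibly a carrier subspace.
  The type \<open>'v fls\<close> serves as \<open>V((x))\<close>.  A formal series in two variables is given by
  its coefficients: \<open>A n m\<close> is the coefficient of the \<open>n\<close>-th power of the first variable
  times the \<open>m\<close>-th power of the second one.  All sums \<^const>\<open>Sum_any\<close> below have finite
  support for the arguments they are meant for.
\<close>

definition fls_scale :: "(complex \<Rightarrow> 'v::ab_group_add \<Rightarrow> 'v) \<Rightarrow> complex \<Rightarrow> 'v fls \<Rightarrow> 'v fls" where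
  "fls_scale s c F = Abs_fls (\<lambda>n. s c (F $$ n))"

text \<open>The library's \<^const>\<open>fls_deriv\<close> needs multiplication on the coefficients.\<close>

definition fls_derivative :: "(complex \<Rightarrow> 'v::ab_group_add \<Rightarrow> 'v) \<Rightarrow> 'v fls \<Rightarrow> 'v fls" where
  "fls_derivative s F = Abs_fls (\<lambda>n. s (of_int (n + 1)) (F $$ (n + 1)))"

text \<open>
  \<open>subst_add s e F n j\<close> is the coefficient of \<open>y^n z^j\<close> in \<open>F(y + e z)\<close>, expanded in
  nonnegative powers of \<open>z\<close>; it comes from the term of \<open>F\<close> of degree \<open>n + j\<close>.
\<close>

definition subst_add ::
    "(complex \<Rightarrow> 'v::ab_group_add \<Rightarrow> 'v) \<Rightarrow> complex \<Rightarrow> 'v fls \<Rightarrow> int \<Rightarrow> nat \<Rightarrow> 'v" where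
  "subst_add s e F n j =
     s (e ^ j * ((of_int (n + int j) :: complex) gchoose j)) (F $$ (n + int j))"

text \<open>The product of \<open>(y + z)^l\<close> with a series in \<open>y\<close> and \<open>z\<close>.\<close>

definition times_binomial ::
    "(complex \<Rightarrow> 'v::ab_group_add \<Rightarrow> 'v) \<Rightarrow> nat \<Rightarrow> (int \<Rightarrow> int \<Rightarrow> 'v) \<Rightarrow> int \<Rightarrow> int \<Rightarrow> 'v" where
  "times_binomial s l A n m =
     (\<Sum>i\<le>l. s (of_nat (l choose i)) (A (n - int (l - i)) (m - int i)))"

text \<open>
  The series in \<open>(x\<^sub>0, x\<^sub>2)\<close> given by \<open>Y\<^sub>W(u, x\<^sub>0 + x\<^sub>2) Y\<^sub>W(v, x\<^sub>2) w\<close> and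
  \<open>Y\<^sub>W(Y(u, x\<^sub>0) v, x\<^sub>2) w\<close>.
\<close>

definition composed_action ::
    "(complex \<Rightarrow> 'w::ab_group_add \<Rightarrow> 'w) \<Rightarrow> ('v \<Rightarrow> 'w \<Rightarrow> 'w fls) \<Rightarrow> 'v \<Rightarrow> 'v \<Rightarrow> 'w \<Rightarrow> int \<Rightarrow> int \<Rightarrow> 'w"
  where
  "composed_action s YW u v w n m =
     Sum_any (\<lambda>j::nat. subst_add s 1 (YW u (YW v w $$ (m - int j))) n j)"

definition iterated_action ::
    "('v \<Rightarrow> 'v \<Rightarrow> 'v::zero fls) \<Rightarrow> ('v \<Rightarrow> 'w \<Rightarrow> 'w::zero fls) \<Rightarrow> 'v \<Rightarrow> 'v \<Rightarrow> 'w \<Rightarrow> int \<Rightarrow> int \<Rightarrow> 'w"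
  where
  "iterated_action Y YW u v w n m = YW (Y u v $$ n) w $$ m"

definition weakly_associative ::
    "(complex \<Rightarrow> 'w::ab_group_add \<Rightarrow> 'w) \<Rightarrow> ('v::zero \<Rightarrow> 'v \<Rightarrow> 'v fls) \<Rightarrow> ('v \<Rightarrow> 'w \<Rightarrow> 'w fls)
       \<Rightarrow> 'v \<Rightarrow> 'v \<Rightarrow> 'w \<Rightarrow> bool" where
  "weakly_associative s Y YW u v w \<longleftrightarrow>
     (\<exists>l. times_binomial s l (composed_action s YW u v w)
        = times_binomial s l (iterated_action Y YW u v w))"

locale nonlocal_vertex_algebra =
  vector_space scale for scale :: "complex \<Rightarrow> 'v::ab_group_add \<Rightarrow> 'v" +
  fixes V :: "'v set"
    and Y :: "'v \<Rightarrow> 'v \<Rightarrow> 'v fls"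
    and vac :: 'v
  assumes V_subspace: "subspace V"
    and vac_in: "vac \<in> V"
    and Y_closed: "\<lbrakk>u \<in> V; v \<in> V\<rbrakk> \<Longrightarrow> Y u v $$ n \<in> V"
    and Y_add_left: "\<lbrakk>u \<in> V; u' \<in> V; v \<in> V\<rbrakk> \<Longrightarrow> Y (u + u') v = Y u v + Y u' v"
    and Y_scale_left: "\<lbrakk>u \<in> V; v \<in> V\<rbrakk> \<Longrightarrow> Y (scale c u) v = fls_scale scale c (Y u v)"
    and Y_add_right: "\<lbrakk>u \<in> V; v \<in> V; v' \<in> V\<rbrakk> \<Longrightarrow> Y u (v + v') = Y u v + Y u v'"
    and Y_scale_right: "\<lbrakk>u \<in> V; v \<in> V\<rbrakk> \<Longrightarrow> Y u (scale c v) = fls_scale scale c (Y u v)"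
    and Y_vac: "v \<in> V \<Longrightarrow> Y vac v = fls_const v"
    and creation_regular: "\<lbrakk>v \<in> V; n < 0\<rbrakk> \<Longrightarrow> Y v vac $$ n = 0"
    and creation_limit: "v \<in> V \<Longrightarrow> Y v vac $$ 0 = v"
    and weak_assoc: "\<lbrakk>u \<in> V; v \<in> V; w \<in> V\<rbrakk> \<Longrightarrow> weakly_associative scale Y Y u v w"

locale nonlocal_vertex_algebra_module =
  nonlocal_vertex_algebra scaleV V Y vac + modvs: vector_space scaleW
  for scaleV :: "complex \<Rightarrow> 'v::ab_group_add \<Rightarrow> 'v" and V Y vac
    and scaleW :: "complex \<Rightarrow> 'w::ab_group_add \<Rightarrow> 'w" +
  fixes W :: "'w set"
    and YW :: "'v \<Rightarrow> 'w \<Rightarrow> 'w fls"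
  assumes W_subspace: "modvs.subspace W"
    and YW_closed: "\<lbrakk>v \<in> V; w \<in> W\<rbrakk> \<Longrightarrow> YW v w $$ n \<in> W"
    and YW_add_left: "\<lbrakk>v \<in> V; v' \<in> V; w \<in> W\<rbrakk> \<Longrightarrow> YW (v + v') w = YW v w + YW v' w"
    and YW_scale_left: "\<lbrakk>v \<in> V; w \<in> W\<rbrakk> \<Longrightarrow> YW (scaleV c v) w = fls_scale scaleW c (YW v w)"
    and YW_add_right: "\<lbrakk>v \<in> V; w \<in> W; w' \<in> W\<rbrakk> \<Longrightarrow> YW v (w + w') = YW v w + YW v w'"
    and YW_scale_right: "\<lbrakk>v \<in> V; w \<in> W\<rbrakk> \<Longrightarrow> YW v (scaleW c w) = fls_scale scaleW c (YW v w)"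
    and YW_vac: "w \<in> W \<Longrightarrow> YW vac w = fls_const w"
    and YW_weak_assoc:
      "\<lbrakk>u \<in> V; v \<in> V; w \<in> W\<rbrakk> \<Longrightarrow> weakly_associative scaleW Y YW u v w"

locale unital_algebra =
  vector_space scale for scale :: "complex \<Rightarrow> 'a::ab_group_add \<Rightarrow> 'a" +
  fixes A :: "'a set"
    and mul :: "'a \<Rightarrow> 'a \<Rightarrow> 'a"
    and one :: 'a
  assumes A_subspace: "subspace A"
    and mul_closed: "\<lbrakk>a \<in> A; b \<in> A\<rbrakk> \<Longrightarrow> mul a b \<in> A"
    and one_closed: "one \<in> A"
    and mul_assoc: "\<lbrakk>a \<in> A; b \<in> A; c \<in> A\<rbrakk> \<Longrightarrow> mul (mul a b) c = mul a (mul b c)"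
    and mul_one_left: "a \<in> A \<Longrightarrow> mul one a = a"
    and mul_one_right: "a \<in> A \<Longrightarrow> mul a one = a"
    and mul_add_left: "\<lbrakk>a \<in> A; a' \<in> A; b \<in> A\<rbrakk> \<Longrightarrow> mul (a + a') b = mul a b + mul a' b"
    and mul_add_right: "\<lbrakk>a \<in> A; b \<in> A; b' \<in> A\<rbrakk> \<Longrightarrow> mul a (b + b') = mul a b + mul a b'"
    and mul_scale_left: "\<lbrakk>a \<in> A; b \<in> A\<rbrakk> \<Longrightarrow> mul (scale k a) b = scale k (mul a b)"
    and mul_scale_right: "\<lbrakk>a \<in> A; b \<in> A\<rbrakk> \<Longrightarrow> mul a (scale k b) = scale k (mul a b)"

locale unital_subalgebra =
  unital_algebra scale A mul one
  for scale :: "complex \<Rightarrow> 'a::ab_group_add \<Rightarrow> 'a" and A mul one +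
  fixes B :: "'a set"
  assumes B_subset: "B \<subseteq> A"
    and B_subspace: "subspace B"
    and B_one: "one \<in> B"
    and B_mul: "\<lbrakk>a \<in> B; b \<in> B\<rbrakk> \<Longrightarrow> mul a b \<in> B"

locale algebra_derivation =
  unital_algebra scale A mul one
  for scale :: "complex \<Rightarrow> 'a::ab_group_add \<Rightarrow> 'a" and A mul one +
  fixes d :: "'a \<Rightarrow> 'a"
  assumes d_closed: "a \<in> A \<Longrightarrow> d a \<in> A"
    and d_add: "\<lbrakk>a \<in> A; b \<in> A\<rbrakk> \<Longrightarrow> d (a + b) = d a + d b"
    and d_scale: "a \<in> A \<Longrightarrow> d (scale k a) = scale k (d a)"
    and d_mul: "\<lbrakk>a \<in> A; b \<in> A\<rbrakk> \<Longrightarrow> d (mul a b) = mul (d a) b + mul a (d b)"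

text \<open>The vertex operators \<open>Y(a, x) b = (e\<^sup>x\<^sup>d a) b\<close> of \<open>(A, d)\<close>.\<close>

definition derivation_Y ::
    "(complex \<Rightarrow> 'a::ab_group_add \<Rightarrow> 'a) \<Rightarrow> ('a \<Rightarrow> 'a \<Rightarrow> 'a) \<Rightarrow> ('a \<Rightarrow> 'a) \<Rightarrow> 'a \<Rightarrow> 'a \<Rightarrow> 'a fls" where
  "derivation_Y scale mul d a b =
     fps_to_fls (Abs_fps (\<lambda>n. mul (scale (1 / fact n) ((d ^^ n) a)) b))"

text \<open>
  \<open>V \<otimes> \<complex>((x))\<close> (an algebraic tensor product) is identified with its image in \<open>V((x))\<close>,
  the set of finite sums of series \<open>f(x) v\<close>.
\<close>

definition pure_tensor :: "(complex \<Rightarrow> 'v::ab_group_add \<Rightarrow> 'v) \<Rightarrow> 'v \<Rightarrow> complex fls \<Rightarrow> 'v fls" where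
  "pure_tensor s v f = Abs_fls (\<lambda>n. s (f $$ n) v)"

definition tensor_laurent :: "(complex \<Rightarrow> 'v::ab_group_add \<Rightarrow> 'v) \<Rightarrow> 'v fls set" where
  "tensor_laurent s = {\<Sum>i<r. pure_tensor s (v i) (f i) | (r::nat) v f. True}"

type_synonym 'v laurent_map = "'v \<Rightarrow> 'v fls"

definition Hom_laurent :: "(complex \<Rightarrow> 'v::ab_group_add \<Rightarrow> 'v) \<Rightarrow> 'v laurent_map set" where
  "Hom_laurent s = {a. Vector_Spaces.linear s (fls_scale s) a \<and> (\<forall>v. a v \<in> tensor_laurent s)}"

definition hom_scale ::
    "(complex \<Rightarrow> 'v::ab_group_add \<Rightarrow> 'v) \<Rightarrow> complex \<Rightarrow> 'v laurent_map \<Rightarrow> 'v laurent_map" where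
  "hom_scale s c a = (\<lambda>v. fls_scale s c (a v))"

text \<open>
  The \<open>\<complex>((x))\<close>-linear extension of \<open>a\<close> to \<open>V \<otimes> \<complex>((x))\<close>: as \<open>a\<close> is \<open>\<complex>\<close>-linear, the map
  \<open>\<Sum>\<^sub>i f\<^sub>i(x) v\<^sub>i \<mapsto> \<Sum>\<^sub>i f\<^sub>i(x) a(x) v\<^sub>i\<close> sends \<open>F(x) = \<Sum>\<^sub>k F\<^sub>k x^k\<close> to \<open>\<Sum>\<^sub>k x^k a(x) F\<^sub>k\<close>.
  The coefficients \<open>F\<^sub>k\<close> span a finite-dimensional space, so the orders of the series
  \<open>a(x) F\<^sub>k\<close> are bounded below, and only finitely many \<open>k\<close> contribute to each coefficient.
\<close>

definition laurent_extension :: "'v::ab_group_add laurent_map \<Rightarrow> 'v fls \<Rightarrow> 'v fls" where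
  "laurent_extension a F = Abs_fls (\<lambda>n. Sum_any (\<lambda>k::int. a (F $$ k) $$ (n - k)))"

text \<open>Composition and identity in the endomorphism algebra of \<open>V \<otimes> \<complex>((x))\<close> over \<open>\<complex>((x))\<close>.\<close>

definition hom_mul :: "'v::ab_group_add laurent_map \<Rightarrow> 'v laurent_map \<Rightarrow> 'v laurent_map" where
  "hom_mul a b = (\<lambda>v. laurent_extension a (b v))"

definition hom_one :: "'v::ab_group_add laurent_map" where
  "hom_one = (\<lambda>v. fls_const v)"

definition hom_deriv ::
    "(complex \<Rightarrow> 'v::ab_group_add \<Rightarrow> 'v) \<Rightarrow> 'v laurent_map \<Rightarrow> 'v laurent_map" where
  "hom_deriv s a = (\<lambda>v. fls_derivative s (a v))"

text \<open>
  The series \<open>a(x\<^sub>1) Y(v, x\<^sub>2) w\<close> in \<open>(x\<^sub>1, x\<^sub>2)\<close>, where \<open>a(x\<^sub>1)\<close> acts on the coefficients of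
  \<open>Y(v, x\<^sub>2) w\<close>.
\<close>

definition left_action ::
    "('v::zero \<Rightarrow> 'v \<Rightarrow> 'v fls) \<Rightarrow> 'v laurent_map \<Rightarrow> 'v \<Rightarrow> 'v \<Rightarrow> int \<Rightarrow> int \<Rightarrow> 'v" where
  "left_action Y a v w n m = a (Y v w $$ m) $$ n"

text \<open>
  The series \<open>Y(a(x\<^sub>1 - x\<^sub>2) v, x\<^sub>2) b(x\<^sub>1) w\<close> in \<open>(x\<^sub>1, x\<^sub>2)\<close>, with \<open>Y\<close> extended linearly over
  scalar Laurent series: the term \<open>x\<^sub>1^k x\<^sub>2^j\<close> of \<open>a(x\<^sub>1 - x\<^sub>2) v\<close> and the term \<open>x\<^sub>1^(n-k)\<close> of
  \<open>b(x\<^sub>1) w\<close> contribute to \<open>x\<^sub>1^n x\<^sub>2^m\<close> the coefficient of \<open>x\<^sub>2^(m-j)\<close> of the vertex operator.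
\<close>

definition right_action ::
    "(complex \<Rightarrow> 'v::ab_group_add \<Rightarrow> 'v) \<Rightarrow> ('v \<Rightarrow> 'v \<Rightarrow> 'v fls) \<Rightarrow> 'v laurent_map \<Rightarrow> 'v laurent_map
       \<Rightarrow> 'v \<Rightarrow> 'v \<Rightarrow> int \<Rightarrow> int \<Rightarrow> 'v" where
  "right_action s Y a b v w n m =
     Sum_any (\<lambda>(k::int, j::nat).
       Y (subst_add s (-1) (a v) k j) (b w $$ (n - k)) $$ (m - int j))"

definition Delta_closed ::
    "(complex \<Rightarrow> 'v::ab_group_add \<Rightarrow> 'v) \<Rightarrow> ('v \<Rightarrow> 'v \<Rightarrow> 'v fls) \<Rightarrow> 'v laurent_map set \<Rightarrow> bool" where
  "Delta_closed s Y U \<longleftrightarrow> U \<subseteq> Hom_laurent s \<and>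
     (\<forall>a\<in>U. \<exists>(r::nat) a1 a2. (\<forall>i<r. a1 i \<in> U \<and> a2 i \<in> U) \<and>
       (\<forall>v w n m. left_action Y a v w n m = (\<Sum>i<r. right_action s Y (a1 i) (a2 i) v w n m)))"

text \<open>The sum of a family of subspaces is the span of its union.\<close>

definition B_space ::
    "(complex \<Rightarrow> 'v::ab_group_add \<Rightarrow> 'v) \<Rightarrow> ('v \<Rightarrow> 'v \<Rightarrow> 'v fls) \<Rightarrow> 'v \<Rightarrow> 'v laurent_map set" where
  "B_space s Y vac = module.span (hom_scale s)
     (\<Union>{U. module.subspace (hom_scale s) U \<and> Delta_closed s Y U \<and>
            (\<forall>a\<in>U. \<exists>c. a vac = fls_const (s c vac))})"

end

theory Submission
  imports Defs
begin

text \<open>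
  Since \<open>B(V)\<close> is the largest subspace that is \<open>\<Delta>\<close>-closed and maps \<open>\<one>\<close> into \<open>\<complex>\<one>\<close>, it suffices to
  check that the identity, products and derivatives of its elements again span such a subspace.
  For \<open>P, Q \<in> V \<otimes> \<complex>((x))\<close> the series \<open>R(P, Q) = Y(P(x\<^sub>1 - x\<^sub>2), x\<^sub>2) Q(x\<^sub>1)\<close> in \<open>V((x\<^sub>1))((x\<^sub>2))\<close> is
  biadditive, and \<open>R(f P, g Q) = f(x\<^sub>1 - x\<^sub>2) g(x\<^sub>1) R(P, Q)\<close>, because \<open>f \<mapsto> f(x\<^sub>1 - x\<^sub>2)\<close> is a ring
  homomorphism commuting with derivatives (Vandermonde).  Hence identities for \<open>R\<close> need only be
  checked on pure tensors.  This gives the coproducts of \<open>a b\<close> (the products of those of \<open>a\<close>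
  and \<open>b\<close>) and of \<open>a'\<close> (Leibniz rule).  For the module axiom, \<open>Y(a, x\<^sub>0) b = a(x\<^sub>2 + x\<^sub>0) b(x\<^sub>2)\<close>; as
  \<open>b(x) w\<close> lies in \<open>V \<otimes> \<complex>((x))\<close>, one power of \<open>x\<close> clears the poles of \<open>a(x)\<close> on all its
  coefficients at once, and after that the two expansions of \<open>a(x\<^sub>0 + x\<^sub>2)\<close> agree.
\<close>

section \<open>Laurent series with coefficients in a module\<close>

text \<open>The Cauchy product with scalars and vectors in different types. As the coefficient
  action \<open>s\<close> is a parameter, the construction can be applied to itself, which yields
  series in two variables.\<close>

definition laurent_smult ::
    "('a::zero \<Rightarrow> 'b::comm_monoid_add \<Rightarrow> 'b) \<Rightarrow> 'a fls \<Rightarrow> 'b fls \<Rightarrow> 'b fls" where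
  "laurent_smult s f G =
     Abs_fls (\<lambda>n. \<Sum>k=fls_subdegree f..n - fls_subdegree G. s (f $$ k) (G $$ (n - k)))"

lemma laurent_smult_nth:
  "laurent_smult s f G $$ n = (\<Sum>k=fls_subdegree f..n - fls_subdegree G. s (f $$ k) (G $$ (n - k)))"
  unfolding laurent_smult_def
  by (rule nth_Abs_fls_lower_bound[of "fls_subdegree f + fls_subdegree G"]) auto

lemma laurent_smult_times: "laurent_smult (*) f g = (f * g :: 'a::comm_ring_1 fls)"
  by (rule fls_eqI) (simp add: laurent_smult_nth fls_times_nth(2))

context module
begin

text \<open>Subdegrees of sums and products are not determined by those of the parts, because of
  cancellation. Comparing several products therefore starts by summing all of them over one larger
  index set; the added terms vanish.\<close>

lemma laurent_smult_nth_superset: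
  assumes "finite S" "{fls_subdegree f..n - fls_subdegree G} \<subseteq> S"
  shows "laurent_smult scale f G $$ n = (\<Sum>k\<in>S. scale (f $$ k) (G $$ (n - k)))"
  unfolding laurent_smult_nth
proof (rule sum.mono_neutral_left[OF assms])
  show "\<forall>k\<in>S - {fls_subdegree f..n - fls_subdegree G}. scale (f $$ k) (G $$ (n - k)) = 0"
  proof
    fix k assume "k \<in> S - {fls_subdegree f..n - fls_subdegree G}"
    then have "k < fls_subdegree f \<or> n - k < fls_subdegree G" by auto
    then show "scale (f $$ k) (G $$ (n - k)) = 0" by auto
  qed
qed

lemma laurent_smult_smult:
  "laurent_smult scale f (laurent_smult scale g H) = laurent_smult scale (f * g) H"
proof (rule fls_eqI)
  fix n
  define df dg e e' where "df = fls_subdegree f" and "dg = fls_subdegree g" and "e = fls_subdegree H"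
    and "e' = fls_subdegree (laurent_smult scale g H)"
  \<comment> \<open>\<open>P\<close> holds the total exponents of \<open>f * g\<close>,
    \<open>S\<close> the exponents of \<open>f\<close>. The minimum and the maximum absorb the
    unknown subdegrees of \<open>f * g\<close> and of \<open>laurent_smult scale g H\<close>, so
    that both orders of summation use the same windows.\<close>
  define P S where "P = {min (df + dg) (fls_subdegree (f * g))..n - e}"
    and "S = {df..max (n - e') (n - e - dg)}"
  \<comment> \<open>The coefficient ring is a module over itself, so the superset lemma also
    computes the coefficients of \<open>f * g\<close>.\<close>
  have mulm: "module ((*) :: 'a \<Rightarrow> 'a \<Rightarrow> 'a)"
    by unfold_locales (auto simp: algebra_simps)
  have inner: "(\<Sum>p\<in>P. scale (g $$ (p - k)) (H $$ (n - p))) = laurent_smult scale g H $$ (n - k)"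
    if "k \<in> S" for k
  proof -
    have "laurent_smult scale g H $$ (n - k) = (\<Sum>l\<in>(\<lambda>p. p - k) ` P. scale (g $$ l) (H $$ (n - k - l)))"
    proof (rule laurent_smult_nth_superset)
      show "{fls_subdegree g..n - k - fls_subdegree H} \<subseteq> (\<lambda>p. p - k) ` P"
      proof
        fix l assume "l \<in> {fls_subdegree g..n - k - fls_subdegree H}"
        with that have "l + k \<in> P" by (auto simp: P_def S_def dg_def e_def)
        then show "l \<in> (\<lambda>p. p - k) ` P" by (rule rev_image_eqI) simp
      qed
    qed (simp add: P_def)
    also have "\<dots> = (\<Sum>p\<in>P. scale (g $$ (p - k)) (H $$ (n - p)))"
      by (subst sum.reindex) (auto simp: inj_on_def)
    finally show ?thesis by simp
  qed
  have "laurent_smult scale (f * g) H $$ n = (\<Sum>p\<in>P. scale ((f * g) $$ p) (H $$ (n - p)))"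
    by (rule laurent_smult_nth_superset) (auto simp: P_def e_def)
  also have "\<dots> = (\<Sum>p\<in>P. scale (\<Sum>k\<in>S. f $$ k * g $$ (p - k)) (H $$ (n - p)))"
  proof (rule sum.cong[OF refl])
    fix p assume "p \<in> P"
    then have "(f * g) $$ p = (\<Sum>k\<in>S. f $$ k * g $$ (p - k))"
      unfolding laurent_smult_times[symmetric]
      by (intro module.laurent_smult_nth_superset[OF mulm]) (auto simp: P_def S_def df_def dg_def)
    then show "scale ((f * g) $$ p) (H $$ (n - p)) = scale (\<Sum>k\<in>S. f $$ k * g $$ (p - k)) (H $$ (n - p))"
      by simp
  qed
  also have "\<dots> = (\<Sum>k\<in>S. scale (f $$ k) (\<Sum>p\<in>P. scale (g $$ (p - k)) (H $$ (n - p))))"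
    by (simp add: scale_sum_left scale_sum_right sum.swap[of _ S P])
  also have "\<dots> = (\<Sum>k\<in>S. scale (f $$ k) (laurent_smult scale g H $$ (n - k)))"
    by (simp add: inner)
  also have "\<dots> = laurent_smult scale f (laurent_smult scale g H) $$ n"
    by (rule laurent_smult_nth_superset[symmetric]) (auto simp: S_def df_def e'_def)
  finally show "laurent_smult scale f (laurent_smult scale g H) $$ n
      = laurent_smult scale (f * g) H $$ n" by simp
qed

lemma laurent_smult_const [simp]: "laurent_smult scale (fls_const c) G $$ n = scale c (G $$ n)"
proof -
  have "laurent_smult scale (fls_const c) G $$ n
      = (\<Sum>k\<in>{0..max 0 (n - fls_subdegree G)}. scale (fls_const c $$ k) (G $$ (n - k)))"
    by (rule laurent_smult_nth_superset) auto
  also have "\<dots> = (\<Sum>k\<in>{0}. scale (fls_const c $$ k) (G $$ (n - k)))"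
    by (rule sum.mono_neutral_right) auto
  finally show ?thesis by simp
qed

lemma laurent_smult_const_right [simp]: "laurent_smult scale f (fls_const v) $$ n = scale (f $$ n) v"
proof -
  have "laurent_smult scale f (fls_const v) $$ n
      = (\<Sum>k\<in>{min n (fls_subdegree f)..n}. scale (f $$ k) (fls_const v $$ (n - k)))"
    by (rule laurent_smult_nth_superset) auto
  also have "\<dots> = (\<Sum>k\<in>{n}. scale (f $$ k) (fls_const v $$ (n - k)))"
    by (rule sum.mono_neutral_right) auto
  finally show ?thesis by simp
qed

text \<open>Because the result is again a module, the passage to Laurent series can be repeated;
  this produces \<open>series2\<close> below.\<close>

lemma module_laurent_smult: "module (laurent_smult scale)"
proof
  fix f g :: "'a fls" and G H :: "'b fls"
  show "laurent_smult scale f (G + H) = laurent_smult scale f G + laurent_smult scale f H"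
  proof (rule fls_eqI)
    fix n
    define S where "S = {fls_subdegree f..n - min (fls_subdegree (G + H)) (min (fls_subdegree G) (fls_subdegree H))}"
    have "laurent_smult scale f K $$ n = (\<Sum>k\<in>S. scale (f $$ k) (K $$ (n - k)))" if "K \<in> {G, H, G + H}" for K
      by (rule laurent_smult_nth_superset) (use that in \<open>auto simp: S_def\<close>)
    then show "laurent_smult scale f (G + H) $$ n = (laurent_smult scale f G + laurent_smult scale f H) $$ n"
      by (simp add: sum.distrib scale_right_distrib)
  qed
  show "laurent_smult scale (f + g) G = laurent_smult scale f G + laurent_smult scale g G"
  proof (rule fls_eqI)
    fix n
    define S where "S = {min (fls_subdegree (f + g)) (min (fls_subdegree f) (fls_subdegree g))..n - fls_subdegree G}"
    have "laurent_smult scale h G $$ n = (\<Sum>k\<in>S. scale (h $$ k) (G $$ (n - k)))" if "h \<in> {f, g, f + g}" for h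
      by (rule laurent_smult_nth_superset) (use that in \<open>auto simp: S_def\<close>)
    then show "laurent_smult scale (f + g) G $$ n = (laurent_smult scale f G + laurent_smult scale g G) $$ n"
      by (simp add: sum.distrib scale_left_distrib)
  qed
  show "laurent_smult scale f (laurent_smult scale g G) = laurent_smult scale (f * g) G"
    by (rule laurent_smult_smult)
  show "laurent_smult scale 1 G = G"
    using laurent_smult_const[of 1 G] by (intro fls_eqI) simp
qed

end

lemma (in module) laurent_smult_nth_support:
  assumes "finite S" "\<And>k. k \<notin> S \<Longrightarrow> scale (f $$ k) (G $$ (n - k)) = 0"
  shows "laurent_smult scale f G $$ n = (\<Sum>k\<in>S. scale (f $$ k) (G $$ (n - k)))"
proof -
  have "laurent_smult scale f G $$ n
      = (\<Sum>k\<in>S \<union> {fls_subdegree f..n - fls_subdegree G}. scale (f $$ k) (G $$ (n - k)))"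
    by (rule laurent_smult_nth_superset) (use assms(1) in auto)
  also have "\<dots> = (\<Sum>k\<in>S. scale (f $$ k) (G $$ (n - k)))"
    by (rule sum.mono_neutral_right) (use assms in auto)
  finally show ?thesis .
qed

lemma fls_times_nth_support:
  fixes f g :: "'a::comm_ring_1 fls"
  assumes "finite S" "\<And>k. k \<notin> S \<Longrightarrow> f $$ k * g $$ (n - k) = 0"
  shows "(f * g) $$ n = (\<Sum>k\<in>S. f $$ k * g $$ (n - k))"
proof -
  interpret module "(*) :: 'a \<Rightarrow> 'a \<Rightarrow> 'a"
    by unfold_locales (auto simp: algebra_simps)
  show ?thesis
    using laurent_smult_nth_support[OF assms] by (simp add: laurent_smult_times)
qed

section \<open>Coefficientwise maps and sums of finite support\<close>

definition fls_map :: "('a::zero \<Rightarrow> 'b::zero) \<Rightarrow> 'a fls \<Rightarrow> 'b fls" where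
  "fls_map h F = Abs_fls (\<lambda>n. h (F $$ n))"

lemma fls_map_nth:
  assumes "h 0 = 0"
  shows "fls_map h F $$ n = h (F $$ n)"
  unfolding fls_map_def
  by (rule nth_Abs_fls_lower_bound[of "fls_subdegree F"]) (simp add: assms)

text \<open>\<open>Sum_any\<close> returns 0 on infinite support, so it is not additive in general.
  Keeping finiteness together with the value gives a relation that is preserved by addition.\<close>

definition has_finite_sum :: "('i \<Rightarrow> 'b::comm_monoid_add) \<Rightarrow> 'b \<Rightarrow> bool" where
  "has_finite_sum g x \<longleftrightarrow> finite {i. g i \<noteq> 0} \<and> Sum_any g = x"

lemma has_finite_sum_0: "has_finite_sum (\<lambda>i. 0) 0"
  by (simp add: has_finite_sum_def)

lemma has_finite_sum_add:
  assumes "has_finite_sum g x" "has_finite_sum h y"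
  shows "has_finite_sum (\<lambda>i. g i + h i) (x + y)"
proof -
  have "finite ({i. g i \<noteq> 0} \<union> {i. h i \<noteq> 0})"
    using assms by (simp add: has_finite_sum_def)
  then have "finite {i. g i + h i \<noteq> 0}"
    by (rule rev_finite_subset) auto
  then show ?thesis
    using assms by (simp add: has_finite_sum_def Sum_any.distrib)
qed

lemma has_finite_sumI:
  assumes "finite S" "\<And>i. i \<notin> S \<Longrightarrow> g i = 0" "sum g S = x"
  shows "has_finite_sum g x"
proof -
  have sub: "{i. g i \<noteq> 0} \<subseteq> S" using assms(2) by auto
  then show ?thesis
    using assms Sum_any.expand_superset[OF assms(1) sub] finite_subset[OF sub]
    by (simp add: has_finite_sum_def)
qed

section \<open>Endomorphisms of the tensor product with Laurent series\<close>

lemma sum_lessThan_concat: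
  "(\<Sum>i<r + r'. if i < r then f i else g (i - r)) = (\<Sum>i<r. f i) + (\<Sum>i<r'. g i :: 'a::ab_group_add)"
  for r r' :: nat
  by (induction r') (auto simp: add.assoc)

locale complex_space = vector_space scale
  for scale :: "complex \<Rightarrow> 'v::ab_group_add \<Rightarrow> 'v"
begin

abbreviation "lsmult \<equiv> laurent_smult scale"

text \<open>The action of \<open>C((x1))((x2))\<close> on \<open>V((x1))((x2))\<close>; throughout,
  \<open>x2\<close> is the outer variable and \<open>x1\<close> the inner one.\<close>

abbreviation "lsmult2 \<equiv> laurent_smult (laurent_smult scale)"

sublocale series: module lsmult
  by (rule module_laurent_smult)

sublocale series2: module lsmult2
  by (rule series.module_laurent_smult)

lemma fls_scale_nth: "fls_scale scale c F $$ n = scale c (F $$ n)"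
  unfolding fls_scale_def by (rule nth_Abs_fls_lower_bound[of "fls_subdegree F"]) simp

lemma fls_scale_eq: "fls_scale scale c F = lsmult (fls_const c) F"
  by (rule fls_eqI) (simp add: fls_scale_nth)

lemma pure_tensor_eq: "pure_tensor scale v f = lsmult f (fls_const v)"
proof (rule fls_eqI)
  fix n
  have "pure_tensor scale v f $$ n = scale (f $$ n) v"
    unfolding pure_tensor_def by (rule nth_Abs_fls_lower_bound[of "fls_subdegree f"]) simp
  then show "pure_tensor scale v f $$ n = lsmult f (fls_const v) $$ n"
    by simp
qed

lemma tensor_laurent_eq:
  "tensor_laurent scale = {\<Sum>i<r. lsmult (f i) (fls_const (v i)) | (r::nat) v f. True}"
  by (simp add: tensor_laurent_def pure_tensor_eq)

lemma tensor_laurentI: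
  "(\<Sum>i<r. lsmult (f i) (fls_const (v i))) \<in> tensor_laurent scale" for r :: nat
  unfolding tensor_laurent_eq mem_Collect_eq
  by (intro exI[of _ r] exI[of _ v] exI[of _ f]) simp

lemma tensor_laurent_0: "0 \<in> tensor_laurent scale"
  using tensor_laurentI[of _ _ 0] by simp

lemma tensor_laurent_pure: "lsmult f (fls_const v) \<in> tensor_laurent scale"
  using tensor_laurentI[of "\<lambda>_. f" "\<lambda>_. v" 1] by simp

lemma tensor_laurent_add:
  assumes "F \<in> tensor_laurent scale" "G \<in> tensor_laurent scale"
  shows "F + G \<in> tensor_laurent scale"
proof -
  obtain r v f where F: "F = (\<Sum>i<r::nat. lsmult (f i) (fls_const (v i)))"
    using assms(1) unfolding tensor_laurent_eq by blast
  obtain r' v' f' where G: "G = (\<Sum>i<r'::nat. lsmult (f' i) (fls_const (v' i)))"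
    using assms(2) unfolding tensor_laurent_eq by blast
  have "F + G = (\<Sum>i<r + r'. if i < r then lsmult (f i) (fls_const (v i))
      else lsmult (f' (i - r)) (fls_const (v' (i - r))))"
    using sum_lessThan_concat[of r "\<lambda>i. lsmult (f i) (fls_const (v i))"
        "\<lambda>i. lsmult (f' i) (fls_const (v' i))" r'] F G
    by simp
  also have "\<dots> = (\<Sum>i<r + r'. lsmult (if i < r then f i else f' (i - r))
      (fls_const (if i < r then v i else v' (i - r))))"
    by (rule sum.cong) auto
  finally show ?thesis by (simp only: tensor_laurentI)
qed

lemma tensor_laurent_const: "fls_const v \<in> tensor_laurent scale"
  using tensor_laurent_pure[of 1 v] by simp

text \<open>Reduces any additive statement on V \<otimes> C((x)) to pure tensors
  \<open>f(x) v\<close>. Most facts below are proved this way.\<close>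

lemma tensor_laurent_induct [consumes 1, case_names zero pure add]:
  assumes "F \<in> tensor_laurent scale"
    and "P 0"
    and pure: "\<And>f v. P (lsmult f (fls_const v))"
    and add: "\<And>F G. \<lbrakk>F \<in> tensor_laurent scale; G \<in> tensor_laurent scale; P F; P G\<rbrakk> \<Longrightarrow> P (F + G)"
  shows "P F"
proof -
  obtain r v f where F: "F = (\<Sum>i<r::nat. lsmult (f i) (fls_const (v i)))"
    using assms(1) unfolding tensor_laurent_eq by blast
  have "(\<Sum>i<r. lsmult (f i) (fls_const (v i))) \<in> tensor_laurent scale \<and> P (\<Sum>i<r. lsmult (f i) (fls_const (v i)))"
    by (induction r) (simp_all add: tensor_laurent_0 tensor_laurent_add tensor_laurent_pure assms(2) pure add)
  then show ?thesis by (simp add: F)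
qed

lemma tensor_laurent_smult:
  assumes "F \<in> tensor_laurent scale"
  shows "lsmult f F \<in> tensor_laurent scale"
  using assms
  by (induction rule: tensor_laurent_induct)
    (simp_all add: tensor_laurent_0 tensor_laurent_pure tensor_laurent_add series.scale_right_distrib)

lemma tensor_laurent_sum:
  "(\<And>i. i \<in> I \<Longrightarrow> F i \<in> tensor_laurent scale) \<Longrightarrow> sum F I \<in> tensor_laurent scale"
  by (induction I rule: infinite_finite_induct) (auto simp: tensor_laurent_0 tensor_laurent_add)

section \<open>Differentiation of series with vector coefficients\<close>

lemma fls_derivative_nth:
  "fls_derivative scale F $$ n = scale (of_int (n + 1)) (F $$ (n + 1))"
  unfolding fls_derivative_def by (rule nth_Abs_fls_lower_bound[of "fls_subdegree F - 1"]) simp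

lemma fls_derivative_add:
  "fls_derivative scale (F + G) = fls_derivative scale F + fls_derivative scale G"
  by (rule fls_eqI) (simp add: fls_derivative_nth scale_right_distrib del: of_int_add)

lemma fls_derivative_0 [simp]: "fls_derivative scale 0 = 0"
  by (rule fls_eqI) (simp add: fls_derivative_nth)

lemma fls_derivative_const [simp]: "fls_derivative scale (fls_const v) = 0"
  by (rule fls_eqI) (auto simp: fls_derivative_nth simp del: of_int_add)

lemma fls_derivative_sum:
  "fls_derivative scale (sum F I) = (\<Sum>i\<in>I. fls_derivative scale (F i))"
  by (induction I rule: infinite_finite_induct) (auto simp: fls_derivative_add)

text \<open>The factor \<open>n + 1\<close> splits as \<open>k + (n + 1 - k)\<close>, the exponents
  contributed by \<open>f\<close> and by \<open>G\<close>; the two parts are the two terms of the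
  product rule.\<close>

lemma fls_derivative_smult:
  "fls_derivative scale (lsmult f G) = lsmult (fls_deriv f) G + lsmult f (fls_derivative scale G)"
proof (rule fls_eqI)
  fix n
  \<comment> \<open>Here \<open>k\<close> is the exponent in \<open>f\<close> before
    differentiation. In \<open>fls_deriv f\<close> it has become \<open>k - 1\<close>, hence the
    shift by one in the bounds and the reindexing.\<close>
  define S where "S = {min (fls_subdegree f) (fls_subdegree (fls_deriv f) + 1)
      ..max (n + 1 - fls_subdegree G) (n - fls_subdegree (fls_derivative scale G))}"
  have "lsmult (fls_deriv f) G $$ n = (\<Sum>k\<in>(\<lambda>k. k - 1) ` S. scale (fls_deriv f $$ k) (G $$ (n - k)))"
  proof (rule laurent_smult_nth_superset)
    show "{fls_subdegree (fls_deriv f)..n - fls_subdegree G} \<subseteq> (\<lambda>k. k - 1) ` S"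
    proof
      fix k assume "k \<in> {fls_subdegree (fls_deriv f)..n - fls_subdegree G}"
      then have "k + 1 \<in> S" by (auto simp: S_def)
      then show "k \<in> (\<lambda>k. k - 1) ` S" by (rule rev_image_eqI) simp
    qed
  qed (simp add: S_def)
  also have "\<dots> = (\<Sum>k\<in>S. scale (of_int k * f $$ k) (G $$ (n + 1 - k)))"
    by (subst sum.reindex) (auto simp: inj_on_def algebra_simps)
  finally have 1: "lsmult (fls_deriv f) G $$ n = (\<Sum>k\<in>S. scale (of_int k * f $$ k) (G $$ (n + 1 - k)))" .
  have 2: "lsmult f (fls_derivative scale G) $$ n
      = (\<Sum>k\<in>S. scale (f $$ k) (fls_derivative scale G $$ (n - k)))"
    by (rule laurent_smult_nth_superset) (auto simp: S_def)
  have 3: "lsmult f G $$ (n + 1) = (\<Sum>k\<in>S. scale (f $$ k) (G $$ (n + 1 - k)))"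
    by (rule laurent_smult_nth_superset) (auto simp: S_def)
  show "fls_derivative scale (lsmult f G) $$ n
      = (lsmult (fls_deriv f) G + lsmult f (fls_derivative scale G)) $$ n"
    by (auto simp add: fls_derivative_nth 1 2 3 scale_sum_right simp flip: sum.distrib scale_left_distrib
        intro!: sum.cong arg_cong2[of _ _ _ _ scale]) (simp_all add: algebra_simps)
qed

lemma tensor_laurent_derivative:
  assumes "F \<in> tensor_laurent scale"
  shows "fls_derivative scale F \<in> tensor_laurent scale"
  using assms
  by (induction rule: tensor_laurent_induct)
    (simp_all add: tensor_laurent_0 tensor_laurent_pure tensor_laurent_add fls_derivative_add fls_derivative_smult)

lemma vector_space_fls_scale: "vector_space (fls_scale scale)"
  by unfold_locales (auto simp: fls_scale_eq series.scale_right_distrib series.scale_left_distrib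
      simp flip: fls_plus_const)

section \<open>The space of maps from V to V \<otimes> C((x)) and their linear extensions\<close>

lemma Hom_laurent_iff:
  "a \<in> Hom_laurent scale \<longleftrightarrow> (\<forall>u v. a (u + v) = a u + a v)
     \<and> (\<forall>c v. a (scale c v) = lsmult (fls_const c) (a v)) \<and> (\<forall>v. a v \<in> tensor_laurent scale)"
  unfolding Hom_laurent_def Vector_Spaces.linear_iff
  using vector_space_axioms vector_space_fls_scale by (auto simp: fls_scale_eq)

lemma Hom_add: "a \<in> Hom_laurent scale \<Longrightarrow> a (u + v) = a u + a v"
  and Hom_scale: "a \<in> Hom_laurent scale \<Longrightarrow> a (scale c v) = lsmult (fls_const c) (a v)"
  and Hom_tensor: "a \<in> Hom_laurent scale \<Longrightarrow> a v \<in> tensor_laurent scale"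
  by (simp_all add: Hom_laurent_iff)

lemma Hom_0: "a \<in> Hom_laurent scale \<Longrightarrow> a 0 = 0"
  using Hom_scale[of a 0 0] by simp

lemma hom_scale_eq: "hom_scale scale c a = (\<lambda>v. lsmult (fls_const c) (a v))"
  by (simp add: hom_scale_def fls_scale_eq)

lemma vector_space_hom_scale: "vector_space (hom_scale scale)"
  by unfold_locales (auto simp: hom_scale_eq fun_eq_iff series.scale_right_distrib series.scale_left_distrib
      simp flip: fls_plus_const)

lemma Hom_subspace: "module.subspace (hom_scale scale) (Hom_laurent scale)"
proof -
  interpret H: vector_space "hom_scale scale" by (rule vector_space_hom_scale)
  show ?thesis
    by (rule H.subspaceI)
      (auto simp: Hom_laurent_iff hom_scale_eq tensor_laurent_0 tensor_laurent_add tensor_laurent_smult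
        series.scale_right_distrib mult.commute)
qed

text \<open>\<open>laurent_extension\<close> is meaningful only if every coefficient is a finite sum
  and the resulting series is bounded below. The relation states both and is additive in
  \<open>F\<close>, so existence on all tensors follows from the pure ones, where the value is
  \<open>f(x) a(x) v\<close>.\<close>

definition has_extension :: "'v laurent_map \<Rightarrow> 'v fls \<Rightarrow> 'v fls \<Rightarrow> bool" where
  "has_extension a F E \<longleftrightarrow> (\<forall>n. has_finite_sum (\<lambda>k. a (F $$ k) $$ (n - k)) (E $$ n))"

lemma has_extension_eq:
  assumes "has_extension a F E"
  shows "laurent_extension a F = E"
proof -
  have "(\<lambda>n. Sum_any (\<lambda>k::int. a (F $$ k) $$ (n - k))) = fls_nth E"
    using assms by (auto simp: has_extension_def has_finite_sum_def)
  then show ?thesis by (simp add: laurent_extension_def fls_nth_inverse)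
qed

lemma has_extension_0: "a \<in> Hom_laurent scale \<Longrightarrow> has_extension a 0 0"
  by (simp add: has_extension_def has_finite_sum_0 Hom_0)

lemma has_extension_add:
  assumes "a \<in> Hom_laurent scale" "has_extension a F E" "has_extension a F' E'"
  shows "has_extension a (F + F') (E + E')"
  using assms by (simp add: has_extension_def has_finite_sum_add Hom_add)

lemma has_extension_pure:
  assumes "a \<in> Hom_laurent scale"
  shows "has_extension a (lsmult f (fls_const v)) (lsmult f (a v))"
  unfolding has_extension_def
proof
  fix n
  show "has_finite_sum (\<lambda>k. a (lsmult f (fls_const v) $$ k) $$ (n - k)) (lsmult f (a v) $$ n)"
  proof (rule has_finite_sumI[of "{fls_subdegree f..n - fls_subdegree (a v)}"])
    fix k assume "k \<notin> {fls_subdegree f..n - fls_subdegree (a v)}"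
    then have "k < fls_subdegree f \<or> n - k < fls_subdegree (a v)" by auto
    then show "a (lsmult f (fls_const v) $$ k) $$ (n - k) = 0"
      by (auto simp: Hom_scale[OF assms])
  qed (simp_all only: laurent_smult_nth[of scale f "a v"] laurent_smult_const_right Hom_scale[OF assms]
      laurent_smult_const finite_atLeastAtMost_int)
qed

lemma has_extension_tensor:
  assumes "a \<in> Hom_laurent scale" "F \<in> tensor_laurent scale"
  shows "has_extension a F (laurent_extension a F)"
proof -
  have "\<exists>E. has_extension a F E"
    using assms(2)
    by (induction rule: tensor_laurent_induct)
      (auto intro: has_extension_0 has_extension_pure has_extension_add assms(1))
  then show ?thesis using has_extension_eq by metis
qed

lemma laurent_extension_pure:
  "a \<in> Hom_laurent scale \<Longrightarrow> laurent_extension a (lsmult f (fls_const v)) = lsmult f (a v)"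
  by (rule has_extension_eq) (rule has_extension_pure)

lemma laurent_extension_const [simp]:
  "a \<in> Hom_laurent scale \<Longrightarrow> laurent_extension a (fls_const v) = a v"
  using laurent_extension_pure[of a 1 v] by simp

lemma laurent_extension_0 [simp]: "a \<in> Hom_laurent scale \<Longrightarrow> laurent_extension a 0 = 0"
  by (rule has_extension_eq) (rule has_extension_0)

lemma laurent_extension_add:
  "\<lbrakk>a \<in> Hom_laurent scale; F \<in> tensor_laurent scale; G \<in> tensor_laurent scale\<rbrakk>
    \<Longrightarrow> laurent_extension a (F + G) = laurent_extension a F + laurent_extension a G"
  by (intro has_extension_eq has_extension_add has_extension_tensor)

lemma laurent_extension_sum:
  assumes "a \<in> Hom_laurent scale"
  shows "(\<And>i. i \<in> I \<Longrightarrow> F i \<in> tensor_laurent scale) \<Longrightarrow>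
    laurent_extension a (sum F I) = (\<Sum>i\<in>I. laurent_extension a (F i))"
  by (induction I rule: infinite_finite_induct)
    (auto simp: laurent_extension_add tensor_laurent_sum assms)

lemma laurent_extension_smult:
  assumes "a \<in> Hom_laurent scale" "F \<in> tensor_laurent scale"
  shows "laurent_extension a (lsmult f F) = lsmult f (laurent_extension a F)"
  using assms(2)
  by (induction rule: tensor_laurent_induct)
    (simp_all add: assms(1) laurent_extension_pure laurent_extension_add tensor_laurent_smult
      series.scale_right_distrib)

lemma tensor_laurent_extension:
  assumes "a \<in> Hom_laurent scale" "F \<in> tensor_laurent scale"
  shows "laurent_extension a F \<in> tensor_laurent scale"
  using assms(2)
  by (induction rule: tensor_laurent_induct)
    (simp_all add: assms(1) laurent_extension_pure laurent_extension_add tensor_laurent_smult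
      tensor_laurent_0 tensor_laurent_add Hom_tensor)

lemma Hom_mul:
  assumes "a \<in> Hom_laurent scale" "b \<in> Hom_laurent scale"
  shows "hom_mul a b \<in> Hom_laurent scale"
  unfolding Hom_laurent_iff[of "hom_mul a b"] using assms
  by (auto simp: hom_mul_def Hom_add Hom_scale Hom_tensor
      laurent_extension_add laurent_extension_smult tensor_laurent_extension)

text \<open>By C((x))-linearity it suffices to compare both sides on constant vectors, where they
  agree by definition of the product. Associativity of \<open>hom_mul\<close> is the case
  \<open>F = c v\<close>.\<close>

lemma laurent_extension_hom_mul:
  assumes "a \<in> Hom_laurent scale" "b \<in> Hom_laurent scale" "F \<in> tensor_laurent scale"
  shows "laurent_extension (hom_mul a b) F = laurent_extension a (laurent_extension b F)"
  using assms(3)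
proof (induction rule: tensor_laurent_induct)
  case (pure f v)
  show ?case
    by (simp add: assms Hom_mul laurent_extension_pure laurent_extension_smult Hom_tensor)
      (simp add: hom_mul_def)
qed (simp_all add: assms Hom_mul laurent_extension_add tensor_laurent_extension)

lemma laurent_extension_add_left:
  assumes "a \<in> Hom_laurent scale" "a' \<in> Hom_laurent scale" "F \<in> tensor_laurent scale"
  shows "laurent_extension (a + a') F = laurent_extension a F + laurent_extension a' F"
proof -
  have "has_extension (a + a') F (laurent_extension a F + laurent_extension a' F)"
    using has_extension_tensor[OF assms(1,3)] has_extension_tensor[OF assms(2,3)]
    by (simp add: has_extension_def has_finite_sum_add)
  then show ?thesis by (rule has_extension_eq)
qed

lemma Hom_hom_scale: "a \<in> Hom_laurent scale \<Longrightarrow> hom_scale scale c a \<in> Hom_laurent scale"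
  by (rule module.subspace_scale[OF _ Hom_subspace])
    (simp_all add: module_iff_vector_space vector_space_hom_scale)

lemma laurent_extension_hom_scale:
  assumes "a \<in> Hom_laurent scale" "F \<in> tensor_laurent scale"
  shows "laurent_extension (hom_scale scale c a) F = lsmult (fls_const c) (laurent_extension a F)"
  using assms(2)
proof (induction rule: tensor_laurent_induct)
  case (pure f v)
  show ?case
    by (simp add: assms(1) Hom_hom_scale laurent_extension_pure) (simp add: hom_scale_eq mult.commute)
qed (simp_all add: assms(1) Hom_hom_scale laurent_extension_add series.scale_right_distrib)

lemma Hom_one: "hom_one \<in> Hom_laurent scale"
  unfolding Hom_laurent_iff hom_one_def
  by (auto simp: fls_plus_const tensor_laurent_const intro!: fls_eqI)

lemma laurent_extension_one: "F \<in> tensor_laurent scale \<Longrightarrow> laurent_extension hom_one F = F"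
  by (induction rule: tensor_laurent_induct)
    (simp_all add: Hom_one laurent_extension_pure laurent_extension_add, simp add: hom_one_def)

lemma Hom_deriv:
  assumes "a \<in> Hom_laurent scale"
  shows "hom_deriv scale a \<in> Hom_laurent scale"
  using assms
  by (auto simp: Hom_laurent_iff hom_deriv_def fls_derivative_add fls_derivative_smult
      tensor_laurent_derivative)

text \<open>The product rule for the action of \<open>a(x)\<close> on a series. On a pure tensor
  \<open>f(x) v\<close> it is the product rule for \<open>f(x) a(x) v\<close>; with
  \<open>F = b v\<close> it makes \<open>hom_deriv\<close> a derivation.\<close>

lemma fls_derivative_extension:
  assumes "a \<in> Hom_laurent scale" "F \<in> tensor_laurent scale"
  shows "fls_derivative scale (laurent_extension a F)
    = laurent_extension (hom_deriv scale a) F + laurent_extension a (fls_derivative scale F)"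
  using assms(2)
proof (induction rule: tensor_laurent_induct)
  case (pure f v)
  have "hom_deriv scale a v = fls_derivative scale (a v)" by (simp add: hom_deriv_def)
  then show ?case
    by (simp add: assms(1) Hom_deriv laurent_extension_pure fls_derivative_smult)
qed (simp_all add: assms(1) Hom_deriv laurent_extension_add fls_derivative_add tensor_laurent_derivative)

lemma algebra_derivation_Hom:
  "algebra_derivation (hom_scale scale) (Hom_laurent scale) hom_mul hom_one (hom_deriv scale)"
proof -
  interpret H: vector_space "hom_scale scale" by (rule vector_space_hom_scale)
  show ?thesis
  proof
    fix a b c a' b' :: "'v laurent_map" and k :: complex
    assume a: "a \<in> Hom_laurent scale"
    then show "hom_mul hom_one a = a" "hom_mul a hom_one = a"
      by (simp_all add: hom_mul_def laurent_extension_one Hom_tensor fun_eq_iff) (simp add: hom_one_def)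
    show "hom_deriv scale (hom_scale scale k a) = hom_scale scale k (hom_deriv scale a)"
      by (simp add: hom_deriv_def hom_scale_eq fls_derivative_smult)
    assume b: "b \<in> Hom_laurent scale"
    show "hom_mul (hom_scale scale k a) b = hom_scale scale k (hom_mul a b)"
      by (simp add: hom_mul_def laurent_extension_hom_scale a b Hom_tensor) (simp add: hom_scale_eq)
    show "hom_mul a (hom_scale scale k b) = hom_scale scale k (hom_mul a b)"
      by (simp add: hom_mul_def hom_scale_eq laurent_extension_smult a b Hom_tensor)
    show "hom_deriv scale (hom_mul a b) = hom_mul (hom_deriv scale a) b + hom_mul a (hom_deriv scale b)"
      by (simp add: hom_deriv_def hom_mul_def fun_eq_iff fls_derivative_extension a b Hom_tensor)
    show "hom_deriv scale (a + b) = hom_deriv scale a + hom_deriv scale b"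
      by (simp add: hom_deriv_def fun_eq_iff fls_derivative_add)
    assume c: "c \<in> Hom_laurent scale"
    show "hom_mul (hom_mul a b) c = hom_mul a (hom_mul b c)"
      using laurent_extension_hom_mul[OF a b Hom_tensor[OF c]] by (simp add: hom_mul_def fun_eq_iff)
  next
    fix a b c :: "'v laurent_map"
    assume abc: "a \<in> Hom_laurent scale" "b \<in> Hom_laurent scale" "c \<in> Hom_laurent scale"
    show "hom_mul (a + b) c = hom_mul a c + hom_mul b c"
      by (simp add: hom_mul_def fun_eq_iff laurent_extension_add_left abc Hom_tensor)
    show "hom_mul a (b + c) = hom_mul a b + hom_mul a c"
      by (simp add: hom_mul_def fun_eq_iff laurent_extension_add abc Hom_tensor)
  qed (simp_all add: Hom_subspace Hom_mul Hom_one Hom_deriv)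
qed

end

section \<open>Nonlocal vertex algebras from derivations\<close>

context algebra_derivation
begin

lemma A_0: "0 \<in> A"
  and A_add: "\<lbrakk>a \<in> A; b \<in> A\<rbrakk> \<Longrightarrow> a + b \<in> A"
  and A_scale: "a \<in> A \<Longrightarrow> scale k a \<in> A"
  using A_subspace by (auto simp: subspace_def)

lemma A_sum: "(\<And>i. i \<in> I \<Longrightarrow> f i \<in> A) \<Longrightarrow> sum f I \<in> A"
  by (induction I rule: infinite_finite_induct) (auto simp: A_0 A_add)

lemma mul_0_right: "a \<in> A \<Longrightarrow> mul a 0 = 0"
  using mul_scale_right[of a 0 0] A_0 by simp

lemma mul_0_left: "a \<in> A \<Longrightarrow> mul 0 a = 0"
  using mul_scale_left[of 0 a 0] A_0 by simp

lemma mul_sum_left: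
  assumes "b \<in> A"
  shows "(\<And>i. i \<in> I \<Longrightarrow> f i \<in> A) \<Longrightarrow> mul (sum f I) b = (\<Sum>i\<in>I. mul (f i) b)"
  by (induction I rule: infinite_finite_induct) (auto simp: mul_0_left assms mul_add_left A_sum)

lemma d_0: "d 0 = 0"
  using d_scale[of 0 0] A_0 by simp

lemma d_sum: "(\<And>i. i \<in> I \<Longrightarrow> f i \<in> A) \<Longrightarrow> d (sum f I) = (\<Sum>i\<in>I. d (f i))"
  by (induction I rule: infinite_finite_induct) (auto simp: d_0 d_add A_sum)

lemma d_one: "d one = 0"
  using d_mul[of one one] by (simp add: one_closed mul_one_left mul_one_right d_closed)

text \<open>The coefficient of \<open>x^n\<close> in \<open>e^(x d) a\<close>.\<close>

definition divided_power :: "nat \<Rightarrow> 'a \<Rightarrow> 'a" where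
  "divided_power n a = scale (1 / fact n) ((d ^^ n) a)"

lemma funpow_d_closed: "a \<in> A \<Longrightarrow> (d ^^ n) a \<in> A"
  by (induction n) (auto simp: d_closed)

lemma divided_power_closed: "a \<in> A \<Longrightarrow> divided_power n a \<in> A"
  by (simp add: divided_power_def funpow_d_closed A_scale)

lemma divided_power_add:
  assumes "a \<in> A" "b \<in> A"
  shows "divided_power n (a + b) = divided_power n a + divided_power n b"
proof -
  have "(d ^^ n) (a + b) = (d ^^ n) a + (d ^^ n) b"
    by (induction n) (auto simp: d_add funpow_d_closed assms)
  then show ?thesis by (simp add: divided_power_def scale_right_distrib)
qed

lemma divided_power_scale:
  assumes "a \<in> A"
  shows "divided_power n (scale k a) = scale k (divided_power n a)"
proof -
  have "(d ^^ n) (scale k a) = scale k ((d ^^ n) a)"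
    by (induction n) (auto simp: d_scale funpow_d_closed assms)
  then show ?thesis by (simp add: divided_power_def)
qed

lemma divided_power_0 [simp]: "divided_power 0 a = a"
  by (simp add: divided_power_def)

lemma divided_power_at_0: "divided_power n 0 = 0"
  using divided_power_scale[of 0 n 0] A_0 by simp

lemma d_divided_power:
  assumes "a \<in> A"
  shows "d (divided_power n a) = scale (of_nat (Suc n)) (divided_power (Suc n) a)"
proof -
  have "(1 / fact n :: complex) = of_nat (Suc n) / fact (Suc n)"
    by (simp del: of_nat_Suc)
  then show ?thesis
    by (simp add: divided_power_def d_scale funpow_d_closed assms del: of_nat_Suc fact_Suc)
qed

text \<open>Since \<open>d\<close> kills the unit, \<open>e^(x d)\<close> fixes it. The factor
  \<open>n + 1\<close> in the recursion can be cancelled over the complex numbers.\<close>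

lemma divided_power_one: "n > 0 \<Longrightarrow> divided_power n one = 0"
proof (induction n)
  case (Suc n)
  have "scale (of_nat (Suc n)) (divided_power (Suc n) one) = 0"
    using d_divided_power[OF one_closed, of n] Suc by (cases "n = 0") (auto simp: d_one d_0 simp del: of_nat_Suc)
  then show ?case by (simp del: of_nat_Suc)
qed simp

text \<open>In coefficients: \<open>e^(x d)\<close> is an algebra homomorphism. The induction
  applies \<open>d\<close> to the formula for \<open>n\<close>, which multiplies the divided power
  by the invertible scalar \<open>n + 1\<close>.\<close>

lemma divided_power_mul:
  assumes "a \<in> A" "b \<in> A"
  shows "divided_power n (mul a b) = (\<Sum>i\<le>n. mul (divided_power i a) (divided_power (n - i) b))"
proof (induction n)
  case (Suc n)
  define T where "T i = mul (divided_power i a) (divided_power (Suc n - i) b)" for i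
  have closed: "divided_power i a \<in> A" "divided_power i b \<in> A" for i
    using assms by (auto simp: divided_power_closed)
  have "scale (of_nat (Suc n)) (divided_power (Suc n) (mul a b)) = d (divided_power n (mul a b))"
    by (simp add: d_divided_power mul_closed assms)
  also have "\<dots> = (\<Sum>i\<le>n. d (mul (divided_power i a) (divided_power (n - i) b)))"
    unfolding Suc by (rule d_sum) (simp add: mul_closed closed)
  also have "\<dots> = (\<Sum>i\<le>n. scale (of_nat (Suc i)) (T (Suc i)) + scale (of_nat (Suc n - i)) (T i))"
  proof (rule sum.cong[OF refl])
    fix i assume "i \<in> {..n}"
    then have "Suc (n - i) = Suc n - i" by auto
    then show "d (mul (divided_power i a) (divided_power (n - i) b))
        = scale (of_nat (Suc i)) (T (Suc i)) + scale (of_nat (Suc n - i)) (T i)"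
      using d_divided_power[OF assms(2), of "n - i"]
      by (simp add: d_mul closed d_divided_power assms mul_scale_left mul_scale_right T_def del: of_nat_Suc)
  qed
  \<comment> \<open>Both sums may be extended to all \<open>i \<le> n + 1\<close> because the new
    end terms have weight 0. The weights \<open>i\<close> and \<open>n + 1 - i\<close> then add up
    to the constant \<open>n + 1\<close>.\<close>
  also have "\<dots> = (\<Sum>i\<le>Suc n. scale (of_nat i) (T i)) + (\<Sum>i\<le>Suc n. scale (of_nat (Suc n - i)) (T i))"
    by (subst sum.atMost_Suc_shift) (simp add: sum.distrib del: of_nat_Suc)
  also have "\<dots> = (\<Sum>i\<le>Suc n. scale (of_nat (Suc n)) (T i))"
    unfolding sum.distrib[symmetric] scale_left_distrib[symmetric] of_nat_add[symmetric]
    by (rule sum.cong) auto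
  finally have "scale (of_nat (Suc n)) (divided_power (Suc n) (mul a b))
      = scale (of_nat (Suc n)) (\<Sum>i\<le>Suc n. T i)"
    by (simp only: scale_sum_right)
  then show ?case unfolding T_def by (simp del: of_nat_Suc sum.atMost_Suc)
qed simp

text \<open>In coefficients: \<open>e^(x2 d) e^(x0 d) = e^((x0 + x2) d)\<close>.\<close>

lemma divided_power_divided_power:
  assumes "a \<in> A"
  shows "divided_power m (divided_power n a) = scale (of_nat ((n + m) choose m)) (divided_power (n + m) a)"
proof -
  have "divided_power m (divided_power n a) = scale (1 / fact m * (1 / fact n)) ((d ^^ (n + m)) a)"
    by (simp add: divided_power_def[of n] divided_power_scale funpow_d_closed assms)
      (simp add: divided_power_def funpow_add[symmetric] add.commute[of n] flip: comp_apply[of "d ^^ m"])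
  moreover have "(1 / fact m * (1 / fact n) :: complex) = of_nat ((n + m) choose m) * (1 / fact (n + m))"
    by (simp add: binomial_fact)
  ultimately show ?thesis by (simp add: divided_power_def)
qed

section \<open>The vertex operators of an algebra with derivation\<close>

abbreviation "dY \<equiv> derivation_Y scale mul d"

lemma derivation_Y_nth:
  "dY a b $$ n = (if n < 0 then 0 else mul (divided_power (nat n) a) b)"
  by (simp add: derivation_Y_def divided_power_def)

text \<open>Associativity holds on the nose: \<open>e^(x2 d)\<close> is multiplicative and
  \<open>e^(x2 d) e^(x0 d) = e^((x0 + x2) d)\<close>, so both sides are
  \<open>(e^((x0 + x2) d) u) (e^(x2 d) v) w\<close>, and any \<open>l\<close> serves as
  witness.\<close>

lemma derivation_Y_weakly_associative:
  assumes uvw: "u \<in> A" "v \<in> A" "w \<in> A"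
  shows "weakly_associative scale dY dY u v w"
proof -
  have "composed_action scale dY u v w n m = iterated_action dY dY u v w n m" for n m
  proof (cases "m < 0 \<or> n < 0")
    case True
    have "subst_add scale 1 (dY u (dY v w $$ (m - int j))) n j = 0" for j
    proof (cases "m < 0 \<or> n + int j < 0")
      case True
      then show ?thesis
        by (auto simp: subst_add_def derivation_Y_nth mul_0_right divided_power_closed uvw)
    next
      case False
      \<comment> \<open>Here \<open>m\<close> and \<open>n + j\<close> are nonnegative, so
        \<open>n\<close> is negative. The coefficient is zero since a nonnegative power of
        \<open>x0 + x2\<close> contains no negative power of \<open>x0\<close>.\<close>
      then have "nat (n + int j) < j" using \<open>m < 0 \<or> n < 0\<close> by auto
      moreover have "(of_int (n + int j) :: complex) = of_nat (nat (n + int j))"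
        using False by auto
      ultimately have "(of_int (n + int j) :: complex) gchoose j = 0"
        by (simp only: binomial_gbinomial[symmetric] binomial_eq_0 of_nat_0)
      then show ?thesis by (simp add: subst_add_def)
    qed
    then show ?thesis
      using True by (auto simp: composed_action_def iterated_action_def derivation_Y_nth
          divided_power_at_0 mul_0_left uvw)
  next
    case False
    then obtain p q where nm: "n = int p" "m = int q"
      by (metis nonneg_int_cases not_less)
    have gb: "(of_int (int p + int j) :: complex) gchoose j = of_nat ((p + j) choose j)" for j
      by (simp add: binomial_gbinomial)
    have "composed_action scale dY u v w n m
        = (\<Sum>j\<le>q. subst_add scale 1 (dY u (dY v w $$ (m - int j))) n j)"
      unfolding composed_action_def
      by (rule Sum_any.expand_superset)
        (auto simp: nm subst_add_def derivation_Y_nth mul_0_right divided_power_closed uvw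
          intro: ccontr)
    also have "\<dots> = (\<Sum>j\<le>q. scale (of_nat ((p + j) choose j))
        (mul (divided_power (p + j) u) (mul (divided_power (q - j) v) w)))"
      by (rule sum.cong) (auto simp: nm subst_add_def gb derivation_Y_nth nat_add_distrib nat_diff_distrib
          simp del: of_int_add)
    also have "\<dots> = (\<Sum>j\<le>q. mul (mul (divided_power j (divided_power p u)) (divided_power (q - j) v)) w)"
      by (rule sum.cong)
        (simp_all add: divided_power_divided_power mul_scale_left mul_closed mul_assoc divided_power_closed uvw)
    also have "\<dots> = mul (divided_power q (mul (divided_power p u) v)) w"
      by (simp add: divided_power_mul mul_sum_left mul_closed divided_power_closed uvw)
    also have "\<dots> = iterated_action dY dY u v w n m"
      by (simp add: nm iterated_action_def derivation_Y_nth)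
    finally show ?thesis .
  qed
  then have "composed_action scale dY u v w = iterated_action dY dY u v w" by (intro ext)
  then show ?thesis unfolding weakly_associative_def by metis
qed

lemma nonlocal_vertex_algebra_derivation_Y: "nonlocal_vertex_algebra scale A dY one"
proof -
  have fls_scale_nth: "fls_scale scale c F $$ n = scale c (F $$ n)" for c n and F :: "'a fls"
    by (rule complex_space.fls_scale_nth) (rule complex_space.intro, rule vector_space_axioms)
  show ?thesis
  proof
    show "dY u v $$ n \<in> A" if "u \<in> A" "v \<in> A" for u v n
      using that by (simp add: derivation_Y_nth A_0 mul_closed divided_power_closed)
    show "dY (u + u') v = dY u v + dY u' v" if "u \<in> A" "u' \<in> A" "v \<in> A" for u u' v
      using that by (intro fls_eqI) (simp add: derivation_Y_nth divided_power_add mul_add_left divided_power_closed)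
    show "dY u (v + v') = dY u v + dY u v'" if "u \<in> A" "v \<in> A" "v' \<in> A" for u v v'
      using that by (intro fls_eqI) (simp add: derivation_Y_nth mul_add_right divided_power_closed)
    show "dY (scale c u) v = fls_scale scale c (dY u v)" if "u \<in> A" "v \<in> A" for u v c
      using that by (intro fls_eqI)
        (simp add: derivation_Y_nth fls_scale_nth divided_power_scale mul_scale_left divided_power_closed)
    show "dY u (scale c v) = fls_scale scale c (dY u v)" if "u \<in> A" "v \<in> A" for u v c
      using that by (intro fls_eqI)
        (simp add: derivation_Y_nth fls_scale_nth mul_scale_right divided_power_closed)
    show "dY one v = fls_const v" if "v \<in> A" for v
      using that by (intro fls_eqI)
        (simp add: derivation_Y_nth mul_one_left divided_power_one mul_0_left)
    show "dY v one $$ n = 0" if "v \<in> A" "n < 0" for v n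
      using that by (simp add: derivation_Y_nth)
    show "dY v one $$ 0 = v" if "v \<in> A" for v
      using that by (simp add: derivation_Y_nth mul_one_right)
  qed (simp_all add: A_subspace one_closed derivation_Y_weakly_associative)
qed

end

section \<open>The right-hand side of the coproduct condition\<close>

text \<open>The coefficient of \<open>x2^j\<close> in \<open>f(x1 - x2)\<close>, as a series in
  \<open>x1\<close>; equivalently \<open>(-1)^j / j!\<close> times the \<open>j\<close>-th
  derivative of \<open>f\<close>.\<close>

definition shift_coeff :: "nat \<Rightarrow> complex fls \<Rightarrow> complex fls" where
  "shift_coeff j f = Abs_fls (\<lambda>n. (- 1) ^ j * (of_int (n + int j) gchoose j) * f $$ (n + int j))"

lemma shift_coeff_nth:
  "shift_coeff j f $$ n = (- 1) ^ j * (of_int (n + int j) gchoose j) * f $$ (n + int j)"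
  unfolding shift_coeff_def by (rule nth_Abs_fls_lower_bound[of "fls_subdegree f - int j"]) simp

text \<open>This says that \<open>f(x) \<mapsto> f(x1 - x2)\<close> is multiplicative. Fixing the
  exponents \<open>p\<close> of \<open>f\<close> and \<open>N - p\<close> of \<open>g\<close>, the
  sum over \<open>i\<close> is the Vandermonde convolution.\<close>

lemma shift_coeff_mult:
  "shift_coeff j (f * g) = (\<Sum>i\<le>j. shift_coeff i f * shift_coeff (j - i) g)"
proof (rule fls_eqI)
  fix n
  define N S where "N = n + int j" and "S = {fls_subdegree f..N - fls_subdegree g}"
  have S: "f $$ p * g $$ (N - p) = 0" if "p \<notin> S" for p
    using that by (auto simp: S_def)
  have "(shift_coeff i f * shift_coeff (j - i) g) $$ n
      = (\<Sum>p\<in>S. (- 1) ^ j * ((of_int p gchoose i) * (of_int (N - p) gchoose (j - i))) * (f $$ p * g $$ (N - p)))"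
    if "i \<le> j" for i
  proof -
    have eq: "n - (p - int i) + int (j - i) = N - p" for p
      using that by (simp add: N_def)
    have pow: "(- 1 :: complex) ^ j = (- 1) ^ i * (- 1) ^ (j - i)"
      using that by (simp flip: power_add)
    have "(shift_coeff i f * shift_coeff (j - i) g) $$ n
        = (\<Sum>k\<in>(\<lambda>p. p - int i) ` S. shift_coeff i f $$ k * shift_coeff (j - i) g $$ (n - k))"
    proof (rule fls_times_nth_support)
      fix k assume "k \<notin> (\<lambda>p. p - int i) ` S"
      then have "k + int i \<notin> S" by force
      then show "shift_coeff i f $$ k * shift_coeff (j - i) g $$ (n - k) = 0"
        unfolding shift_coeff_nth eq[of "k + int i", unfolded add_diff_cancel_right']
        using S[of "k + int i"] by auto
    qed (simp add: S_def)
    also have "\<dots> = (\<Sum>p\<in>S. shift_coeff i f $$ (p - int i) * shift_coeff (j - i) g $$ (n - (p - int i)))"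
      by (subst sum.reindex) (auto simp: inj_on_def)
    also have "\<dots> = (\<Sum>p\<in>S. (- 1) ^ j * ((of_int p gchoose i) * (of_int (N - p) gchoose (j - i))) * (f $$ p * g $$ (N - p)))"
      by (rule sum.cong[OF refl]) (simp only: shift_coeff_nth eq pow diff_add_cancel, simp only: ac_simps)
    finally show ?thesis .
  qed
  then have "(\<Sum>i\<le>j. shift_coeff i f * shift_coeff (j - i) g) $$ n
      = (\<Sum>i\<le>j. \<Sum>p\<in>S. (- 1) ^ j * ((of_int p gchoose i) * (of_int (N - p) gchoose (j - i))) * (f $$ p * g $$ (N - p)))"
    by (simp add: fls_nth_sum)
  also have "\<dots> = (\<Sum>p\<in>S. (- 1) ^ j * (\<Sum>i\<le>j. (of_int p gchoose i) * (of_int (N - p) gchoose (j - i))) * (f $$ p * g $$ (N - p)))"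
    by (subst sum.swap) (simp add: sum_distrib_left sum_distrib_right)
  also have "\<dots> = (\<Sum>p\<in>S. (- 1) ^ j * (of_int N gchoose j) * (f $$ p * g $$ (N - p)))"
  proof (rule sum.cong[OF refl])
    fix p
    have "(\<Sum>i\<le>j. (of_int p gchoose i) * (of_int (N - p) gchoose (j - i))) = (of_int N gchoose j :: complex)"
      using gbinomial_Vandermonde[of "of_int p :: complex" "of_int (N - p)" j] by (simp add: atLeast0AtMost)
    then show "(- 1) ^ j * (\<Sum>i\<le>j. (of_int p gchoose i) * (of_int (N - p) gchoose (j - i))) * (f $$ p * g $$ (N - p))
        = (- 1) ^ j * (of_int N gchoose j) * (f $$ p * g $$ (N - p))" by simp
  qed
  also have "\<dots> = shift_coeff j (f * g) $$ n"
    using fls_times_nth_support[of S f g N] S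
    by (simp add: shift_coeff_nth S_def N_def sum_distrib_left)
  finally show "shift_coeff j (f * g) $$ n = (\<Sum>i\<le>j. shift_coeff i f * shift_coeff (j - i) g) $$ n" by simp
qed

text \<open>Differentiating before the substitution equals differentiating in \<open>x1\<close>
  after it. In coefficients this is the absorption identity for binomials with upper index
  \<open>n + 1 + j\<close>.\<close>

lemma shift_coeff_deriv: "shift_coeff j (fls_deriv f) = fls_deriv (shift_coeff j f)"
proof (rule fls_eqI)
  fix n
  have "(of_int (n + 1) :: complex) * (of_int (n + 1 + int j) gchoose j)
      = of_int (n + 1 + int j) * (of_int (n + int j) gchoose j)"
    using gbinomial_absorb_comp[of "of_int (n + 1 + int j) :: complex" j] by simp
  from arg_cong[OF this, of "\<lambda>x. (- 1) ^ j * x * f $$ (n + 1 + int j)"]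
  show "shift_coeff j (fls_deriv f) $$ n = fls_deriv (shift_coeff j f) $$ n"
    by (simp only: shift_coeff_nth fls_deriv_nth ac_simps)
qed

text \<open>The series \<open>f(x\<^sub>1 - x\<^sub>2) g(x\<^sub>1)\<close> in \<open>\<complex>((x\<^sub>1))((x\<^sub>2))\<close>; the outer variable is \<open>x\<^sub>2\<close>.\<close>

definition shift_series :: "complex fls \<Rightarrow> complex fls \<Rightarrow> complex fls fls" where
  "shift_series f g = fps_to_fls (Abs_fps (\<lambda>j. shift_coeff j f)) * fls_const g"

lemma shift_series_nth:
  "shift_series f g $$ j = (if j < 0 then 0 else shift_coeff (nat j) f * g)"
  by (simp add: shift_series_def)

lemma shift_series_mult:
  "shift_series f g * shift_series f' g' = shift_series (f * f') (g * g')"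
proof -
  have "Abs_fps (\<lambda>j. shift_coeff j (f * f')) = Abs_fps (\<lambda>j. shift_coeff j f) * Abs_fps (\<lambda>j. shift_coeff j f')"
    by (rule fps_ext) (simp add: shift_coeff_mult fps_mult_nth atLeast0AtMost)
  then have "shift_series (f * f') (g * g')
      = fps_to_fls (Abs_fps (\<lambda>j. shift_coeff j f)) * fps_to_fls (Abs_fps (\<lambda>j. shift_coeff j f'))
        * (fls_const g * fls_const g')"
    by (simp add: shift_series_def fls_times_fps_to_fls)
  then show ?thesis
    by (simp add: shift_series_def mult.assoc mult.left_commute del: fls_const_mult_const)
qed

text \<open>\<open>fls_map fls_deriv\<close> differentiates the inner variable \<open>x1\<close>, so
  this is the product rule for \<open>f(x1 - x2) g(x1)\<close>.\<close>

lemma shift_series_deriv: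
  "shift_series (fls_deriv f) g + shift_series f (fls_deriv g) = fls_map fls_deriv (shift_series f g)"
  by (rule fls_eqI) (simp add: fls_map_nth shift_series_nth shift_coeff_deriv)

section \<open>Operators in the inner variable acting on two-variable products\<close>

context complex_space
begin

lemma lsmult2_nth_support:
  assumes "finite S" "\<And>k. k \<notin> S \<Longrightarrow> lsmult (c $$ k) (H $$ (m - k)) = 0"
  shows "lsmult2 c H $$ m = (\<Sum>k\<in>S. lsmult (c $$ k) (H $$ (m - k)))"
  using assms by (rule series.laurent_smult_nth_support)

text \<open>\<open>fls_map fls_const G\<close> is \<open>G(x2)\<close> viewed as constant in
  \<open>x1\<close>. As the extension of \<open>a\<close> is C((x1))-linear, the scalar series
  \<open>c(x1, x2)\<close> comes out and \<open>a(x1)\<close> acts on the coefficients of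
  \<open>G\<close>.\<close>

lemma fls_map_extension_lsmult2:
  assumes "a \<in> Hom_laurent scale"
  shows "fls_map (laurent_extension a) (lsmult2 c (fls_map fls_const G)) = lsmult2 c (fls_map a G)"
proof (rule fls_eqI)
  fix m
  define S where "S = {fls_subdegree c..m - fls_subdegree G}"
  have S: "c $$ k = 0 \<or> G $$ (m - k) = 0" if "k \<notin> S" for k
    using that by (auto simp: S_def)
  have 1: "lsmult2 c (fls_map fls_const G) $$ m = (\<Sum>k\<in>S. lsmult (c $$ k) (fls_const (G $$ (m - k))))"
    by (subst lsmult2_nth_support[of S]) (use S in \<open>auto simp: S_def fls_map_nth\<close>)
  have 2: "lsmult2 c (fls_map a G) $$ m = (\<Sum>k\<in>S. lsmult (c $$ k) (a (G $$ (m - k))))"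
    by (subst lsmult2_nth_support[of S]) (use S in \<open>auto simp: S_def fls_map_nth Hom_0[OF assms]\<close>)
  show "fls_map (laurent_extension a) (lsmult2 c (fls_map fls_const G)) $$ m = lsmult2 c (fls_map a G) $$ m"
    by (simp add: fls_map_nth assms 1 2 laurent_extension_sum tensor_laurent_pure laurent_extension_pure)
qed

lemma fls_map_derivative_lsmult2:
  "fls_map (fls_derivative scale) (lsmult2 c H)
    = lsmult2 (fls_map fls_deriv c) H + lsmult2 c (fls_map (fls_derivative scale) H)"
proof (rule fls_eqI)
  fix m
  define S where "S = {fls_subdegree c..m - fls_subdegree H}"
  have S: "c $$ k = 0 \<or> H $$ (m - k) = 0" if "k \<notin> S" for k
    using that by (auto simp: S_def)
  have 1: "lsmult2 c H $$ m = (\<Sum>k\<in>S. lsmult (c $$ k) (H $$ (m - k)))"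
    by (subst lsmult2_nth_support[of S]) (use S in \<open>auto simp: S_def fls_map_nth\<close>)
  have 2: "lsmult2 (fls_map fls_deriv c) H $$ m = (\<Sum>k\<in>S. lsmult (fls_deriv (c $$ k)) (H $$ (m - k)))"
    by (subst lsmult2_nth_support[of S]) (use S in \<open>auto simp: S_def fls_map_nth\<close>)
  have 3: "lsmult2 c (fls_map (fls_derivative scale) H) $$ m
      = (\<Sum>k\<in>S. lsmult (c $$ k) (fls_derivative scale (H $$ (m - k))))"
    by (subst lsmult2_nth_support[of S]) (use S in \<open>auto simp: S_def fls_map_nth\<close>)
  show "fls_map (fls_derivative scale) (lsmult2 c H) $$ m
      = (lsmult2 (fls_map fls_deriv c) H + lsmult2 c (fls_map (fls_derivative scale) H)) $$ m"
    by (simp add: fls_map_nth 1 2 3 fls_derivative_sum fls_derivative_smult sum.distrib)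
qed

end

section \<open>The biadditive series \<open>Y(P(x1 - x2), x2) Q(x1)\<close>\<close>

locale bilinear_operators = complex_space scale
  for scale :: "complex \<Rightarrow> 'v::ab_group_add \<Rightarrow> 'v" +
  fixes Y :: "'v \<Rightarrow> 'v \<Rightarrow> 'v fls"
  assumes Y_add_left: "Y (u + u') v = Y u v + Y u' v"
    and Y_scale_left: "Y (scale c u) v = fls_scale scale c (Y u v)"
    and Y_add_right: "Y u (v + v') = Y u v + Y u v'"
    and Y_scale_right: "Y u (scale c v) = fls_scale scale c (Y u v)"
begin

lemma Y_0 [simp]: "Y 0 v = 0" "Y u 0 = 0"
  using Y_add_left[of 0 0 v] Y_add_right[of u 0 0] by simp_all

text \<open>As for \<open>has_extension\<close>, finiteness of all coefficient sums and membership
  in \<open>V((x1))((x2))\<close> are asserted together. The index order is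
  \<open>H $$ m $$ n\<close> because \<open>x2\<close> is the outer variable.\<close>

definition has_right_action :: "'v fls \<Rightarrow> 'v fls \<Rightarrow> 'v fls fls \<Rightarrow> bool" where
  "has_right_action P Q H \<longleftrightarrow> (\<forall>n m. has_finite_sum (\<lambda>(k::int, j::nat).
     Y (subst_add scale (- 1) P k j) (Q $$ (n - k)) $$ (m - int j)) (H $$ m $$ n))"

text \<open>The description is sound because \<open>has_right_action\<close> determines every
  coefficient of \<open>H\<close>; existence on tensors is shown in
  \<open>has_right_action_tensor\<close>.\<close>

definition right_series :: "'v fls \<Rightarrow> 'v fls \<Rightarrow> 'v fls fls" where
  "right_series P Q = (THE H. has_right_action P Q H)"

lemma has_right_action_eq:
  assumes "has_right_action P Q H"
  shows "right_series P Q = H"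
  unfolding right_series_def
proof (rule the_equality)
  show "has_right_action P Q H" by (rule assms)
next
  fix H' assume "has_right_action P Q H'"
  then have "H' $$ m $$ n = H $$ m $$ n" for m n
    using assms unfolding has_right_action_def has_finite_sum_def by metis
  then show "H' = H" by (intro fls_eqI) simp
qed

lemma has_right_action_0: "has_right_action 0 Q 0" "has_right_action P 0 0"
  unfolding has_right_action_def
  by (auto simp: subst_add_def split_def intro: has_finite_sum_0)

lemma has_right_action_add_left:
  "\<lbrakk>has_right_action P Q H; has_right_action P' Q H'\<rbrakk> \<Longrightarrow> has_right_action (P + P') Q (H + H')"
  by (auto simp: has_right_action_def subst_add_def split_def scale_right_distrib Y_add_left
      dest: spec intro!: has_finite_sum_add)

lemma has_right_action_add_right:
  "\<lbrakk>has_right_action P Q H; has_right_action P Q' H'\<rbrakk> \<Longrightarrow> has_right_action P (Q + Q') (H + H')"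
  by (auto simp: has_right_action_def subst_add_def split_def Y_add_right
      dest: spec intro!: has_finite_sum_add)

text \<open>Bilinearity pulls the scalars out of \<open>Y\<close>, leaving the scalar series
  \<open>f(x1 - x2) g(x1)\<close> times \<open>Y(v, x2) w\<close>.\<close>

lemma has_right_action_pure:
  "has_right_action (lsmult f (fls_const v)) (lsmult g (fls_const w))
     (lsmult2 (shift_series f g) (fls_map fls_const (Y v w)))"
  unfolding has_right_action_def
proof (intro allI)
  fix n m
  \<comment> \<open>The lower bound on exponents of \<open>Y v w\<close> forces
    \<open>j \<le> q\<close>. Given that, \<open>k + j\<close> must reach the subdegree of
    \<open>f\<close> and \<open>n - k\<close> that of \<open>g\<close>, so \<open>k\<close> lies in
    \<open>K\<close>.\<close>
  define q K where "q = nat (m - fls_subdegree (Y v w))"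
    and "K = {fls_subdegree f - int q..n - fls_subdegree g}"
  have high: "Y v w $$ (m - int j) = 0" if "\<not> j \<le> q" for j
    using that by (simp add: q_def)
  have K: "shift_coeff j f $$ k * g $$ (n - k) = 0" if "k \<notin> K" "j \<le> q" for k j
    using that by (auto simp: K_def shift_coeff_nth)
  have term_eq: "Y (subst_add scale (- 1) (lsmult f (fls_const v)) k j)
      (lsmult g (fls_const w) $$ (n - k)) $$ (m - int j)
      = scale (shift_coeff j f $$ k * g $$ (n - k)) (Y v w $$ (m - int j))" for k j
    by (simp add: subst_add_def shift_coeff_nth Y_scale_left Y_scale_right fls_scale_nth ac_simps)
  have "lsmult2 (shift_series f g) (fls_map fls_const (Y v w)) $$ m
      = (\<Sum>k\<in>int ` {..q}. lsmult (shift_series f g $$ k) (fls_map fls_const (Y v w) $$ (m - k)))"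
  proof (rule lsmult2_nth_support)
    fix k assume k: "k \<notin> int ` {..q}"
    show "lsmult (shift_series f g $$ k) (fls_map fls_const (Y v w) $$ (m - k)) = 0"
    proof (cases "k < 0")
      case False
      with k have "\<not> nat k \<le> q" by (metis atMost_iff image_eqI int_nat_eq not_less)
      with False high[of "nat k"] show ?thesis by (simp add: fls_map_nth)
    qed (simp add: shift_series_nth)
  qed simp
  also have "\<dots> = (\<Sum>j\<le>q. lsmult (shift_coeff j f * g) (fls_const (Y v w $$ (m - int j))))"
    by (subst sum.reindex) (auto simp: shift_series_nth fls_map_nth)
  finally have "lsmult2 (shift_series f g) (fls_map fls_const (Y v w)) $$ m $$ n
      = (\<Sum>j\<le>q. scale ((shift_coeff j f * g) $$ n) (Y v w $$ (m - int j)))"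
    by (simp add: fls_nth_sum)
  also have "\<dots> = (\<Sum>j\<le>q. \<Sum>k\<in>K. scale (shift_coeff j f $$ k * g $$ (n - k)) (Y v w $$ (m - int j)))"
  proof (rule sum.cong[OF refl])
    fix j assume "j \<in> {..q}"
    then have "(shift_coeff j f * g) $$ n = (\<Sum>k\<in>K. shift_coeff j f $$ k * g $$ (n - k))"
      by (intro fls_times_nth_support) (auto simp: K simp del: mult_eq_0_iff, simp add: K_def)
    then show "scale ((shift_coeff j f * g) $$ n) (Y v w $$ (m - int j))
        = (\<Sum>k\<in>K. scale (shift_coeff j f $$ k * g $$ (n - k)) (Y v w $$ (m - int j)))"
      by (simp add: scale_sum_left)
  qed
  also have "\<dots> = (\<Sum>(k, j)\<in>K \<times> {..q}. scale (shift_coeff j f $$ k * g $$ (n - k)) (Y v w $$ (m - int j)))"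
    by (subst sum.swap) (simp add: sum.cartesian_product)
  finally have sum_eq: "lsmult2 (shift_series f g) (fls_map fls_const (Y v w)) $$ m $$ n = \<dots>" .
  show "has_finite_sum (\<lambda>(k, j). Y (subst_add scale (- 1) (lsmult f (fls_const v)) k j)
      (lsmult g (fls_const w) $$ (n - k)) $$ (m - int j))
      (lsmult2 (shift_series f g) (fls_map fls_const (Y v w)) $$ m $$ n)"
    unfolding term_eq sum_eq
  proof (rule has_finite_sumI[of "K \<times> {..q}"])
    fix i assume "i \<notin> K \<times> {..q}"
    then show "(case i of (k, j) \<Rightarrow> scale (shift_coeff j f $$ k * g $$ (n - k)) (Y v w $$ (m - int j))) = 0"
      using K high by (cases i; cases "snd i \<le> q") (auto simp del: mult_eq_0_iff)
  qed (simp_all add: K_def)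
qed

lemma has_right_action_tensor:
  assumes "P \<in> tensor_laurent scale" "Q \<in> tensor_laurent scale"
  shows "has_right_action P Q (right_series P Q)"
proof -
  have "\<exists>H. has_right_action P Q H"
    using assms(1)
  proof (induction rule: tensor_laurent_induct)
    case (pure f v)
    show ?case using assms(2)
      by (induction rule: tensor_laurent_induct)
        (blast intro: has_right_action_0 has_right_action_pure has_right_action_add_right)+
  qed (blast intro: has_right_action_0 has_right_action_add_left)+
  then show ?thesis using has_right_action_eq by metis
qed

lemma right_series_0 [simp]: "right_series 0 Q = 0" "right_series P 0 = 0"
  by (simp_all add: has_right_action_eq has_right_action_0)

lemma right_series_pure:
  "right_series (lsmult f (fls_const v)) (lsmult g (fls_const w))
    = lsmult2 (shift_series f g) (fls_map fls_const (Y v w))"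
  by (rule has_right_action_eq) (rule has_right_action_pure)

lemma right_series_add_left:
  "\<lbrakk>P \<in> tensor_laurent scale; P' \<in> tensor_laurent scale; Q \<in> tensor_laurent scale\<rbrakk>
    \<Longrightarrow> right_series (P + P') Q = right_series P Q + right_series P' Q"
  by (intro has_right_action_eq has_right_action_add_left has_right_action_tensor)

lemma right_series_add_right:
  "\<lbrakk>P \<in> tensor_laurent scale; Q \<in> tensor_laurent scale; Q' \<in> tensor_laurent scale\<rbrakk>
    \<Longrightarrow> right_series P (Q + Q') = right_series P Q + right_series P Q'"
  by (intro has_right_action_eq has_right_action_add_right has_right_action_tensor)

lemma tensor_laurent_induct2 [consumes 2, case_names zero_left zero_right pure add_left add_right]:
  assumes "P \<in> tensor_laurent scale" "Q \<in> tensor_laurent scale"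
    and "\<And>Q. Q \<in> tensor_laurent scale \<Longrightarrow> R 0 Q" "\<And>P. P \<in> tensor_laurent scale \<Longrightarrow> R P 0"
    and "\<And>f v g w. R (lsmult f (fls_const v)) (lsmult g (fls_const w))"
    and "\<And>P P' Q. \<lbrakk>P \<in> tensor_laurent scale; P' \<in> tensor_laurent scale; Q \<in> tensor_laurent scale;
      R P Q; R P' Q\<rbrakk> \<Longrightarrow> R (P + P') Q"
    and "\<And>P Q Q'. \<lbrakk>P \<in> tensor_laurent scale; Q \<in> tensor_laurent scale; Q' \<in> tensor_laurent scale;
      R P Q; R P Q'\<rbrakk> \<Longrightarrow> R P (Q + Q')"
  shows "R P Q"
  using assms(1)
proof (induction rule: tensor_laurent_induct)
  case (pure f v)
  show ?case using assms(2)
    by (induction rule: tensor_laurent_induct) (simp_all add: assms tensor_laurent_pure)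
qed (simp_all add: assms)

text \<open>Guarantees that a further operator \<open>a(x1)\<close> can be extended to each
  \<open>x2\<close>-coefficient.\<close>

lemma tensor_laurent_right_series:
  assumes "P \<in> tensor_laurent scale" "Q \<in> tensor_laurent scale"
  shows "right_series P Q $$ m \<in> tensor_laurent scale"
  using assms
proof (induction rule: tensor_laurent_induct2)
  case (pure f v g w)
  show ?case
    by (auto simp: right_series_pure laurent_smult_nth[of lsmult] fls_map_nth
        intro!: tensor_laurent_sum tensor_laurent_pure)
qed (simp_all add: tensor_laurent_0 right_series_add_left right_series_add_right tensor_laurent_add)

lemma right_series_lsmult:
  assumes "P \<in> tensor_laurent scale" "Q \<in> tensor_laurent scale"
  shows "right_series (lsmult f P) (lsmult g Q) = lsmult2 (shift_series f g) (right_series P Q)"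
  using assms
proof (induction rule: tensor_laurent_induct2)
  case (pure f' v g' w)
  show ?case by (simp add: right_series_pure shift_series_mult)
qed (simp_all add: right_series_add_left right_series_add_right tensor_laurent_smult
    series.scale_right_distrib series2.scale_right_distrib)

text \<open>The derivative is taken in \<open>x1\<close>. On pure tensors \<open>Y(v, x2) w\<close>
  is constant in \<open>x1\<close>, so only \<open>f(x1 - x2) g(x1)\<close> is
  differentiated.\<close>

lemma right_series_derivative:
  assumes "P \<in> tensor_laurent scale" "Q \<in> tensor_laurent scale"
  shows "fls_map (fls_derivative scale) (right_series P Q)
    = right_series (fls_derivative scale P) Q + right_series P (fls_derivative scale Q)"
  using assms
proof (induction rule: tensor_laurent_induct2)
  case (pure f v g w)
  have "fls_map (fls_derivative scale) (fls_map fls_const (Y v w)) = 0"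
    by (rule fls_eqI) (simp add: fls_map_nth)
  then show ?case
    by (simp add: right_series_pure fls_derivative_smult fls_map_derivative_lsmult2
        flip: shift_series_deriv series2.scale_left_distrib)
next
  case zero_left
  then show ?case by (auto intro!: fls_eqI simp: fls_map_nth)
next
  case zero_right
  then show ?case by (auto intro!: fls_eqI simp: fls_map_nth)
next
  case (add_left P P' Q)
  have "fls_map (fls_derivative scale) (right_series P Q + right_series P' Q)
      = fls_map (fls_derivative scale) (right_series P Q) + fls_map (fls_derivative scale) (right_series P' Q)"
    by (rule fls_eqI) (simp add: fls_map_nth fls_derivative_add)
  with add_left show ?case
    by (simp add: right_series_add_left fls_derivative_add tensor_laurent_derivative)
next
  case (add_right P Q Q')
  have "fls_map (fls_derivative scale) (right_series P Q + right_series P Q')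
      = fls_map (fls_derivative scale) (right_series P Q) + fls_map (fls_derivative scale) (right_series P Q')"
    by (rule fls_eqI) (simp add: fls_map_nth fls_derivative_add)
  with add_right show ?case
    by (simp add: right_series_add_right fls_derivative_add tensor_laurent_derivative)
qed

text \<open>The coproduct condition of \<open>a\<close>, given for \<open>Y(v, x2) w\<close>,
  carries over to \<open>Y(P(x1 - x2), x2) Q(x1)\<close>: on pure tensors the scalar series passes
  through \<open>a(x1)\<close> and is absorbed again by each summand through
  \<open>right_series_lsmult\<close>. This is what makes coproducts of products computable.\<close>

lemma fls_map_extension_right_series:
  assumes PQ: "P \<in> tensor_laurent scale" "Q \<in> tensor_laurent scale"
    and a: "a \<in> Hom_laurent scale"
    and a12: "\<And>i. i \<in> I \<Longrightarrow> a1 i \<in> Hom_laurent scale" "\<And>i. i \<in> I \<Longrightarrow> a2 i \<in> Hom_laurent scale"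
    and decomp: "\<And>v w. fls_map a (Y v w) = (\<Sum>i\<in>I. right_series (a1 i v) (a2 i w))"
  shows "fls_map (laurent_extension a) (right_series P Q)
    = (\<Sum>i\<in>I. right_series (laurent_extension (a1 i) P) (laurent_extension (a2 i) Q))"
  using PQ
proof (induction rule: tensor_laurent_induct2)
  case (pure f v g w)
  show ?case
    by (simp add: right_series_pure fls_map_extension_lsmult2 a a12 decomp laurent_extension_pure
        right_series_lsmult Hom_tensor series2.scale_sum_right)
next
  case zero_left
  then show ?case by (auto intro!: fls_eqI simp: fls_map_nth a a12)
next
  case zero_right
  then show ?case by (auto intro!: fls_eqI simp: fls_map_nth a a12)
next
  case (add_left P P' Q)
  have "fls_map (laurent_extension a) (right_series P Q + right_series P' Q)
      = fls_map (laurent_extension a) (right_series P Q) + fls_map (laurent_extension a) (right_series P' Q)"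
    by (rule fls_eqI) (simp add: fls_map_nth a laurent_extension_add tensor_laurent_right_series add_left(1-3))
  with add_left show ?case
    by (simp add: right_series_add_left a12 laurent_extension_add tensor_laurent_extension sum.distrib)
next
  case (add_right P Q Q')
  have "fls_map (laurent_extension a) (right_series P Q + right_series P Q')
      = fls_map (laurent_extension a) (right_series P Q) + fls_map (laurent_extension a) (right_series P Q')"
    by (rule fls_eqI) (simp add: fls_map_nth a laurent_extension_add tensor_laurent_right_series add_right(1-3))
  with add_right show ?case
    by (simp add: right_series_add_right a12 laurent_extension_add tensor_laurent_extension sum.distrib)
qed

lemma right_action_nth:
  assumes "a \<in> Hom_laurent scale" "b \<in> Hom_laurent scale"
  shows "right_action scale Y a b v w n m = right_series (a v) (b w) $$ m $$ n"
  using has_right_action_tensor[OF Hom_tensor[OF assms(1)] Hom_tensor[OF assms(2)]]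
  by (simp add: right_action_def has_right_action_def has_finite_sum_def)

lemma left_action_nth:
  assumes "a \<in> Hom_laurent scale"
  shows "left_action Y a v w n m = fls_map a (Y v w) $$ m $$ n"
  by (simp add: left_action_def fls_map_nth Hom_0[OF assms])

end

section \<open>The largest closed subspace\<close>

lemma shift_series_const: "shift_series (fls_const c) 1 = fls_const (fls_const c)"
proof -
  have "shift_coeff j (fls_const c) = (if j = 0 then fls_const c else 0)" for j
  proof (rule fls_eqI)
    fix n
    show "shift_coeff j (fls_const c) $$ n = (if j = 0 then fls_const c else 0) $$ n"
      by (cases "n + int j = 0") (auto simp: shift_coeff_nth gbinomial_0_left simp del: of_int_add)
  qed
  then show ?thesis
    by (intro fls_eqI) (auto simp: shift_series_nth)
qed

section \<open>Coproducts of sums, scalar multiples, products and derivatives\<close>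

context bilinear_operators
begin

definition decomposable :: "'v laurent_map set \<Rightarrow> 'v laurent_map \<Rightarrow> bool" where
  "decomposable U a \<longleftrightarrow> (\<exists>(r::nat) a1 a2. (\<forall>i<r. a1 i \<in> U \<and> a2 i \<in> U) \<and>
     (\<forall>v w. fls_map a (Y v w) = (\<Sum>i<r. right_series (a1 i v) (a2 i w))))"

text \<open>Allows an arbitrary finite index set, so that products and disjoint unions of index sets
  can be used directly below.\<close>

lemma decomposableI:
  assumes "finite I" "\<And>i. i \<in> I \<Longrightarrow> a1 i \<in> U" "\<And>i. i \<in> I \<Longrightarrow> a2 i \<in> U"
    and "\<And>v w. fls_map a (Y v w) = (\<Sum>i\<in>I. right_series (a1 i v) (a2 i w))"
  shows "decomposable U a"
proof -
  obtain h where h: "bij_betw h {..<card I} I"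
    using ex_bij_betw_nat_finite[OF assms(1)] by (auto simp: atLeast0LessThan)
  show ?thesis
    unfolding decomposable_def
  proof (intro exI conjI allI impI)
    fix v w
    show "fls_map a (Y v w) = (\<Sum>i<card I. right_series ((a1 \<circ> h) i v) ((a2 \<circ> h) i w))"
      unfolding assms(4) comp_apply by (rule sum.reindex_bij_betw[OF h, symmetric])
  qed (use bij_betwE[OF h] assms(2,3) in auto)
qed

lemma decomposable_mono: "\<lbrakk>decomposable U a; U \<subseteq> U'\<rbrakk> \<Longrightarrow> decomposable U' a"
  unfolding decomposable_def by blast

lemma decomposable_0: "decomposable U 0"
  by (rule decomposableI[of "{}"]) (auto intro!: fls_eqI simp: fls_map_nth)

lemma decomposable_add:
  assumes "a \<in> Hom_laurent scale" "b \<in> Hom_laurent scale" "decomposable U a" "decomposable U b"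
  shows "decomposable U (a + b)"
proof -
  obtain r :: nat and a1 a2 where a: "\<And>i. i < r \<Longrightarrow> a1 i \<in> U \<and> a2 i \<in> U"
    "\<And>v w. fls_map a (Y v w) = (\<Sum>i<r. right_series (a1 i v) (a2 i w))"
    using assms(3) unfolding decomposable_def by blast
  obtain q :: nat and b1 b2 where b: "\<And>i. i < q \<Longrightarrow> b1 i \<in> U \<and> b2 i \<in> U"
    "\<And>v w. fls_map b (Y v w) = (\<Sum>i<q. right_series (b1 i v) (b2 i w))"
    using assms(4) unfolding decomposable_def by blast
  show ?thesis
  proof (rule decomposableI[of "{..<r} <+> {..<q}" "case_sum a1 b1" U "case_sum a2 b2"])
    fix v w
    have "fls_map (a + b) (Y v w) = fls_map a (Y v w) + fls_map b (Y v w)"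
      by (rule fls_eqI) (simp add: fls_map_nth Hom_0 assms)
    then show "fls_map (a + b) (Y v w)
        = (\<Sum>i\<in>{..<r} <+> {..<q}. right_series (case_sum a1 b1 i v) (case_sum a2 b2 i w))"
      by (simp add: a b sum.Plus comp_def)
  qed (use a(1) b(1) in auto)
qed

lemma decomposable_scale:
  assumes a: "a \<in> Hom_laurent scale" "decomposable U a"
    and U: "U \<subseteq> Hom_laurent scale" "\<And>b. b \<in> U \<Longrightarrow> hom_scale scale c b \<in> U"
  shows "decomposable U (hom_scale scale c a)"
proof -
  obtain r :: nat and a1 a2 where a12: "\<And>i. i < r \<Longrightarrow> a1 i \<in> U \<and> a2 i \<in> U"
    "\<And>v w. fls_map a (Y v w) = (\<Sum>i<r. right_series (a1 i v) (a2 i w))"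
    using a(2) unfolding decomposable_def by blast
  \<comment> \<open>A constant is unchanged by the substitution \<open>x1 - x2\<close>, so the
    scalar can be placed on the first tensor factor.\<close>
  have rs: "right_series (lsmult (fls_const c) P) Q = lsmult2 (fls_const (fls_const c)) (right_series P Q)"
    if "P \<in> tensor_laurent scale" "Q \<in> tensor_laurent scale" for P Q
    using right_series_lsmult[OF that, of "fls_const c" 1] by (simp add: shift_series_const)
  show ?thesis
  proof (rule decomposableI[of "{..<r}" "\<lambda>i. hom_scale scale c (a1 i)" U a2])
    fix v w
    have "fls_map (hom_scale scale c a) (Y v w) = lsmult2 (fls_const (fls_const c)) (fls_map a (Y v w))"
      by (rule fls_eqI) (simp add: fls_map_nth hom_scale_eq Hom_0 a)
    also have "\<dots> = (\<Sum>i<r. right_series (hom_scale scale c (a1 i) v) (a2 i w))"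
      unfolding a12 series2.scale_sum_right
      by (rule sum.cong) (use a12(1) U(1) in \<open>auto simp: hom_scale_eq intro!: rs[symmetric] Hom_tensor\<close>)
    finally show "fls_map (hom_scale scale c a) (Y v w)
        = (\<Sum>i<r. right_series (hom_scale scale c (a1 i) v) (a2 i w))" .
  qed (use a12(1) U in auto)
qed

lemma decomposable_one: "decomposable {hom_one} hom_one"
proof (rule decomposableI[of "{()}" "\<lambda>_. hom_one" _ "\<lambda>_. hom_one"])
  fix v w
  have "right_series (fls_const v) (fls_const w) = fls_map fls_const (Y v w)"
    using right_series_pure[of 1 v 1 w] shift_series_const[of 1] by simp
  then show "fls_map hom_one (Y v w) = (\<Sum>i\<in>{()}. right_series (hom_one v) (hom_one w))"
    by (simp add: hom_one_def fls_map_def)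
qed auto

text \<open>The coproduct is multiplicative: first expand \<open>b(x1) Y(v, x2) w\<close>, then move
  \<open>a(x1)\<close> through each summand. The factors are the products \<open>a1 b1\<close> and
  \<open>a2 b2\<close>.\<close>

lemma decomposable_mul:
  assumes U: "U \<subseteq> Hom_laurent scale" and a: "a \<in> Hom_laurent scale" "decomposable U a"
    and b: "b \<in> Hom_laurent scale" "decomposable U b"
  shows "decomposable {hom_mul a b | a b. a \<in> U \<and> b \<in> U} (hom_mul a b)"
proof -
  obtain r :: nat and a1 a2 where a12: "\<And>i. i < r \<Longrightarrow> a1 i \<in> U \<and> a2 i \<in> U"
    "\<And>v w. fls_map a (Y v w) = (\<Sum>i<r. right_series (a1 i v) (a2 i w))"
    using a(2) unfolding decomposable_def by blast
  obtain q :: nat and b1 b2 where b12: "\<And>i. i < q \<Longrightarrow> b1 i \<in> U \<and> b2 i \<in> U"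
    "\<And>v w. fls_map b (Y v w) = (\<Sum>i<q. right_series (b1 i v) (b2 i w))"
    using b(2) unfolding decomposable_def by blast
  have tensor: "b1 i v \<in> tensor_laurent scale" "b2 i v \<in> tensor_laurent scale" if "i < q" for i v
    using b12(1)[OF that] U Hom_tensor by auto
  show ?thesis
  proof (rule decomposableI[of "{..<q} \<times> {..<r}" "\<lambda>(i, k). hom_mul (a1 k) (b1 i)" _
        "\<lambda>(i, k). hom_mul (a2 k) (b2 i)"])
    fix v w
    have "fls_map (hom_mul a b) (Y v w) = fls_map (laurent_extension a) (fls_map b (Y v w))"
      by (rule fls_eqI) (simp add: fls_map_nth hom_mul_def a b Hom_0)
    also have "\<dots> = (\<Sum>i<q. fls_map (laurent_extension a) (right_series (b1 i v) (b2 i w)))"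
      unfolding b12(2)
      by (rule fls_eqI)
        (auto simp: fls_map_nth a fls_nth_sum
          intro!: laurent_extension_sum[OF a(1)] tensor_laurent_right_series tensor)
    also have "\<dots> = (\<Sum>i<q. \<Sum>k<r. right_series (hom_mul (a1 k) (b1 i) v) (hom_mul (a2 k) (b2 i) w))"
      unfolding hom_mul_def
      by (intro sum.cong refl fls_map_extension_right_series) (use tensor a a12 U in auto)
    also have "\<dots> = (\<Sum>x\<in>{..<q} \<times> {..<r}. right_series ((case x of (i, k) \<Rightarrow> hom_mul (a1 k) (b1 i)) v)
        ((case x of (i, k) \<Rightarrow> hom_mul (a2 k) (b2 i)) w))"
      by (simp add: sum.cartesian_product split_def)
    finally show "fls_map (hom_mul a b) (Y v w) = \<dots>" .
  qed (use a12(1) b12(1) in auto)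
qed

text \<open>Differentiating the coproduct identity in \<open>x1\<close> gives the terms
  \<open>a1' \<otimes> a2\<close> and \<open>a1 \<otimes> a2'\<close>. Each mixes an element of
  \<open>U\<close> with a derivative, hence the union.\<close>

lemma decomposable_deriv:
  assumes U: "U \<subseteq> Hom_laurent scale" and a: "a \<in> Hom_laurent scale" "decomposable U a"
  shows "decomposable (U \<union> hom_deriv scale ` U) (hom_deriv scale a)"
proof -
  obtain r :: nat and a1 a2 where a12: "\<And>i. i < r \<Longrightarrow> a1 i \<in> U \<and> a2 i \<in> U"
    "\<And>v w. fls_map a (Y v w) = (\<Sum>i<r. right_series (a1 i v) (a2 i w))"
    using a(2) unfolding decomposable_def by blast
  have tensor: "a1 i v \<in> tensor_laurent scale" "a2 i v \<in> tensor_laurent scale" if "i < r" for i v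
    using a12(1)[OF that] U Hom_tensor by auto
  show ?thesis
  proof (rule decomposableI[of "{..<r} <+> {..<r}" "case_sum (\<lambda>i. hom_deriv scale (a1 i)) a1" _
        "case_sum a2 (\<lambda>i. hom_deriv scale (a2 i))"])
    fix v w
    have "fls_map (hom_deriv scale a) (Y v w) = fls_map (fls_derivative scale) (fls_map a (Y v w))"
      by (rule fls_eqI) (simp add: fls_map_nth hom_deriv_def a Hom_0)
    also have "\<dots> = (\<Sum>i<r. fls_map (fls_derivative scale) (right_series (a1 i v) (a2 i w)))"
      by (rule fls_eqI) (simp add: a12(2) fls_map_nth fls_nth_sum fls_derivative_sum)
    also have "\<dots> = (\<Sum>i<r. right_series (hom_deriv scale (a1 i) v) (a2 i w)
        + right_series (a1 i v) (hom_deriv scale (a2 i) w))"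
      by (rule sum.cong) (auto simp: hom_deriv_def tensor intro: right_series_derivative)
    finally show "fls_map (hom_deriv scale a) (Y v w) = (\<Sum>i\<in>{..<r} <+> {..<r}.
        right_series (case_sum (\<lambda>i. hom_deriv scale (a1 i)) a1 i v)
          (case_sum a2 (\<lambda>i. hom_deriv scale (a2 i)) i w))"
      by (simp add: sum.Plus comp_def sum.distrib)
  qed (use a12(1) in auto)
qed

text \<open>Inside \<open>Hom_laurent\<close> all coefficient sums are finite, so the
  coefficientwise condition becomes an equation between series.\<close>

lemma Delta_closed_iff:
  "Delta_closed scale Y U \<longleftrightarrow> U \<subseteq> Hom_laurent scale \<and> (\<forall>a\<in>U. decomposable U a)"
proof -
  have eq: "(\<forall>v w n m. left_action Y a v w n m = (\<Sum>i<r. right_action scale Y (a1 i) (a2 i) v w n m))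
      \<longleftrightarrow> (\<forall>v w. fls_map a (Y v w) = (\<Sum>i<r. right_series (a1 i v) (a2 i w)))"
    if "U \<subseteq> Hom_laurent scale" "a \<in> U" "\<forall>i<r. a1 i \<in> U \<and> a2 i \<in> U" for a a1 a2 and r :: nat
  proof -
    have "left_action Y a v w n m = fls_map a (Y v w) $$ m $$ n" for v w n m
      using that by (intro left_action_nth) auto
    moreover have "(\<Sum>i<r. right_action scale Y (a1 i) (a2 i) v w n m)
        = (\<Sum>i<r. right_series (a1 i v) (a2 i w)) $$ m $$ n" for v w n m
      unfolding fls_nth_sum using that by (intro sum.cong refl right_action_nth) auto
    ultimately show ?thesis by (simp add: fls_eq_iff) blast
  qed
  show ?thesis
  proof (cases "U \<subseteq> Hom_laurent scale")
    case True
    have "(\<exists>(r::nat) a1 a2. (\<forall>i<r. a1 i \<in> U \<and> a2 i \<in> U) \<and>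
          (\<forall>v w n m. left_action Y a v w n m = (\<Sum>i<r. right_action scale Y (a1 i) (a2 i) v w n m)))
        \<longleftrightarrow> decomposable U a" if "a \<in> U" for a
      unfolding decomposable_def
      by (intro ex_cong1 conj_cong refl eq[OF True that])
    with True show ?thesis unfolding Delta_closed_def by simp
  qed (simp add: Delta_closed_def)
qed

section \<open>Maximality of B(V) and its closure properties\<close>

definition admissible :: "'v \<Rightarrow> 'v laurent_map set \<Rightarrow> bool" where
  "admissible vac U \<longleftrightarrow> module.subspace (hom_scale scale) U \<and> Delta_closed scale Y U \<and>
     (\<forall>a\<in>U. \<exists>c. a vac = fls_const (scale c vac))"

lemma B_space_eq: "B_space scale Y vac = module.span (hom_scale scale) (\<Union>{U. admissible vac U})"
  by (simp add: B_space_def admissible_def)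

text \<open>Each requirement on a single element (being in \<open>Hom_laurent\<close> and
  decomposable over the span, or sending the vacuum to a multiple of itself) cuts out a subspace. If
  it holds on \<open>S\<close>, it holds on the span.\<close>

lemma admissible_span:
  assumes "S \<subseteq> Hom_laurent scale" "\<And>a. a \<in> S \<Longrightarrow> decomposable (module.span (hom_scale scale) S) a"
    and vac: "\<And>a. a \<in> S \<Longrightarrow> \<exists>c. a vac = fls_const (scale c vac)"
  shows "admissible vac (module.span (hom_scale scale) S)"
proof -
  interpret H: vector_space "hom_scale scale" by (rule vector_space_hom_scale)
  have span_Hom: "H.span S \<subseteq> Hom_laurent scale"
    by (rule H.span_minimal[OF assms(1) Hom_subspace])
  have "H.subspace {a. a \<in> Hom_laurent scale \<and> decomposable (H.span S) a}"
  proof (rule H.subspaceI)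
    show "0 \<in> {a. a \<in> Hom_laurent scale \<and> decomposable (H.span S) a}"
      by (simp add: decomposable_0 H.subspace_0[OF Hom_subspace])
    show "a + b \<in> {a. a \<in> Hom_laurent scale \<and> decomposable (H.span S) a}"
      if "a \<in> {a. a \<in> Hom_laurent scale \<and> decomposable (H.span S) a}"
        "b \<in> {a. a \<in> Hom_laurent scale \<and> decomposable (H.span S) a}" for a b
      using that by (simp add: decomposable_add H.subspace_add[OF Hom_subspace])
    show "hom_scale scale c a \<in> {a. a \<in> Hom_laurent scale \<and> decomposable (H.span S) a}"
      if "a \<in> {a. a \<in> Hom_laurent scale \<and> decomposable (H.span S) a}" for a c
      using that by (simp add: decomposable_scale Hom_hom_scale span_Hom H.span_scale)
  qed
  then have "H.span S \<subseteq> {a. a \<in> Hom_laurent scale \<and> decomposable (H.span S) a}"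
    by (rule H.span_minimal[rotated]) (use assms in auto)
  moreover have "H.subspace {a. \<exists>c. a vac = fls_const (scale c vac)}"
  proof (rule H.subspaceI)
    show "0 \<in> {a. \<exists>c. a vac = fls_const (scale c vac)}"
      by (auto intro: exI[of _ 0])
    show "a + b \<in> {a. \<exists>c. a vac = fls_const (scale c vac)}"
      if "a \<in> {a. \<exists>c. a vac = fls_const (scale c vac)}" "b \<in> {a. \<exists>c. a vac = fls_const (scale c vac)}" for a b
      using that by (auto simp: fls_plus_const simp flip: scale_left_distrib)
    show "hom_scale scale k a \<in> {a. \<exists>c. a vac = fls_const (scale c vac)}"
      if a: "a \<in> {a. \<exists>c. a vac = fls_const (scale c vac)}" for a k
    proof -
      from a obtain c where "a vac = fls_const (scale c vac)" by auto
      then have "hom_scale scale k a vac = fls_const (scale (k * c) vac)"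
        by (intro fls_eqI) (simp add: hom_scale_eq)
      then show ?thesis by auto
    qed
  qed
  then have "H.span S \<subseteq> {a. \<exists>c. a vac = fls_const (scale c vac)}"
    by (rule H.span_minimal[rotated]) (use vac in auto)
  ultimately show ?thesis
    by (auto simp: admissible_def Delta_closed_iff)
qed

lemma admissible_B_space: "admissible vac (B_space scale Y vac)"
proof -
  interpret H: vector_space "hom_scale scale" by (rule vector_space_hom_scale)
  show ?thesis
    unfolding B_space_eq
  proof (rule admissible_span)
    show "\<Union>{U. admissible vac U} \<subseteq> Hom_laurent scale"
      by (auto simp: admissible_def Delta_closed_def)
    fix a assume "a \<in> \<Union>{U. admissible vac U}"
    then obtain U where U: "admissible vac U" "a \<in> U" by blast
    then show "\<exists>c. a vac = fls_const (scale c vac)" by (auto simp: admissible_def)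
    have "U \<subseteq> H.span (\<Union>{U. admissible vac U})"
      using U(1) H.span_superset[of "\<Union>{U. admissible vac U}"] by blast
    moreover have "decomposable U a" using U by (auto simp: admissible_def Delta_closed_iff)
    ultimately show "decomposable (H.span (\<Union>{U. admissible vac U})) a"
      by (rule decomposable_mono[rotated])
  qed
qed

text \<open>A criterion for plain sets: passing to the span gives an admissible subspace, which is
  one of those summed up in B(V). It is applied to the identity, to the products, and to B(V) with
  its derivatives.\<close>

lemma B_space_greatest:
  assumes "S \<subseteq> Hom_laurent scale" "\<And>a. a \<in> S \<Longrightarrow> decomposable S a"
    and "\<And>a. a \<in> S \<Longrightarrow> \<exists>c. a vac = fls_const (scale c vac)"
  shows "S \<subseteq> B_space scale Y vac"
proof -
  interpret H: vector_space "hom_scale scale" by (rule vector_space_hom_scale)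
  have "admissible vac (H.span S)"
    by (rule admissible_span)
      (use assms in \<open>auto intro: decomposable_mono[OF _ H.span_superset]\<close>)
  then have "H.span S \<subseteq> \<Union>{U. admissible vac U}" by blast
  then show ?thesis
    unfolding B_space_eq using H.span_superset order_trans by metis
qed

lemma B_space_subspace: "module.subspace (hom_scale scale) (B_space scale Y vac)"
  and B_space_Delta_closed: "Delta_closed scale Y (B_space scale Y vac)"
  and B_space_subset: "B_space scale Y vac \<subseteq> Hom_laurent scale"
  and B_space_decomposable: "a \<in> B_space scale Y vac \<Longrightarrow> decomposable (B_space scale Y vac) a"
  and B_space_vac: "a \<in> B_space scale Y vac \<Longrightarrow> \<exists>c. a vac = fls_const (scale c vac)"
  using admissible_B_space[of vac] unfolding admissible_def Delta_closed_iff by blast+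

lemma B_space_one: "hom_one \<in> B_space scale Y vac"
proof -
  have "\<exists>c. hom_one vac = fls_const (scale c vac)"
    by (rule exI[of _ 1]) (simp add: hom_one_def)
  then show ?thesis
    using B_space_greatest[of "{hom_one}" vac] by (auto simp: Hom_one decomposable_one)
qed

lemma B_space_mul:
  assumes "a \<in> B_space scale Y vac" "b \<in> B_space scale Y vac"
  shows "hom_mul a b \<in> B_space scale Y vac"
proof -
  have "{hom_mul a b | a b. a \<in> B_space scale Y vac \<and> b \<in> B_space scale Y vac} \<subseteq> B_space scale Y vac"
  proof (rule B_space_greatest)
    show "{hom_mul a b | a b. a \<in> B_space scale Y vac \<and> b \<in> B_space scale Y vac} \<subseteq> Hom_laurent scale"
      using B_space_subset[of vac] by (auto intro!: Hom_mul)
  next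
    fix x assume "x \<in> {hom_mul a b | a b. a \<in> B_space scale Y vac \<and> b \<in> B_space scale Y vac}"
    then obtain a b where ab: "x = hom_mul a b" "a \<in> B_space scale Y vac" "b \<in> B_space scale Y vac"
      by auto
    then have Hom: "a \<in> Hom_laurent scale" "b \<in> Hom_laurent scale"
      using B_space_subset[of vac] by auto
    show "decomposable {hom_mul a b | a b. a \<in> B_space scale Y vac \<and> b \<in> B_space scale Y vac} x"
      unfolding ab(1) by (rule decomposable_mul) (use ab Hom B_space_subset[of vac] B_space_decomposable[of _ vac] in auto)
    obtain c d where "a vac = fls_const (scale c vac)" "b vac = fls_const (scale d vac)"
      using B_space_vac[OF ab(2)] B_space_vac[OF ab(3)] by blast
    \<comment> \<open>\<open>b\<close> turns the vacuum into the constant series \<open>d\<close>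
      times the vacuum, on which the extension of \<open>a\<close> is \<open>a\<close>
      itself.\<close>
    then have "x vac = fls_const (scale (d * c) vac)"
      by (intro fls_eqI) (simp add: ab(1) hom_mul_def Hom Hom_scale)
    then show "\<exists>c. x vac = fls_const (scale c vac)" by blast
  qed
  with assms show ?thesis by blast
qed

lemma B_space_deriv:
  assumes "a \<in> B_space scale Y vac"
  shows "hom_deriv scale a \<in> B_space scale Y vac"
proof -
  \<comment> \<open>B(V) is included in the test set because coproducts of derivatives also contain
    undifferentiated factors.\<close>
  have "B_space scale Y vac \<union> hom_deriv scale ` B_space scale Y vac \<subseteq> B_space scale Y vac"
  proof (rule B_space_greatest)
    show "B_space scale Y vac \<union> hom_deriv scale ` B_space scale Y vac \<subseteq> Hom_laurent scale"
      using B_space_subset[of vac] by (auto intro!: Hom_deriv)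
  next
    fix x assume x: "x \<in> B_space scale Y vac \<union> hom_deriv scale ` B_space scale Y vac"
    show "decomposable (B_space scale Y vac \<union> hom_deriv scale ` B_space scale Y vac) x"
    proof (cases "x \<in> B_space scale Y vac")
      case True
      from B_space_decomposable[OF this] show ?thesis by (rule decomposable_mono) simp
    next
      case False
      with x obtain a where "x = hom_deriv scale a" "a \<in> B_space scale Y vac" by auto
      with B_space_subset[of vac] B_space_decomposable[of a vac] show ?thesis
        by (auto intro!: decomposable_deriv)
    qed
    \<comment> \<open>A constant series has derivative zero, so the scalar is 0.\<close>
    have "\<exists>c. hom_deriv scale a vac = fls_const (scale c vac)" if a: "a \<in> B_space scale Y vac" for a
    proof -
      from B_space_vac[OF a] obtain c where "a vac = fls_const (scale c vac)" by blast
      then have "hom_deriv scale a vac = fls_const (scale 0 vac)" by (simp add: hom_deriv_def)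
      then show ?thesis by blast
    qed
    with x show "\<exists>c. x vac = fls_const (scale c vac)"
      using B_space_vac[of x vac] by blast
  qed
  with assms show ?thesis by blast
qed

lemma algebra_derivation_B_space:
  "algebra_derivation (hom_scale scale) (B_space scale Y vac) hom_mul hom_one (hom_deriv scale)"
proof -
  interpret D: algebra_derivation "hom_scale scale" "Hom_laurent scale" hom_mul hom_one "hom_deriv scale"
    by (rule algebra_derivation_Hom)
  have Hom: "a \<in> B_space scale Y vac \<Longrightarrow> a \<in> Hom_laurent scale" for a
    using B_space_subset[of vac] by blast
  show ?thesis
    by unfold_locales
      (simp_all add: Hom B_space_subspace B_space_one B_space_mul B_space_deriv D.mul_assoc D.mul_one_left
        D.mul_one_right D.mul_add_left D.mul_add_right D.mul_scale_left D.mul_scale_right D.d_add D.d_scale D.d_mul)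
qed

end

section \<open>The module axiom\<close>

text \<open>The coefficient of \<open>t^j\<close> in \<open>(1 + t)^z\<close> for every integer
  \<open>j\<close>. The value 0 at negative \<open>j\<close> lets index shifts be made without side
  conditions.\<close>

definition int_binomial :: "int \<Rightarrow> int \<Rightarrow> complex" where
  "int_binomial z j = (if j < 0 then 0 else of_int z gchoose nat j)"

text \<open>In coefficients: \<open>(1 + t)^l (1 + t)^z = (1 + t)^(z + l)\<close>.\<close>

lemma int_binomial_Vandermonde:
  "(\<Sum>i\<le>l. of_nat (l choose i) * int_binomial z (j - int i)) = int_binomial (z + int l) j"
proof (cases "j < 0")
  case False
  then obtain q where q: "j = int q" by (metis nonneg_int_cases not_less)
  have "(\<Sum>i\<le>l. of_nat (l choose i) * int_binomial z (j - int i))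
      = (\<Sum>i\<le>l + q. of_nat (l choose i) * int_binomial z (j - int i))"
    by (rule sum.mono_neutral_left) auto
  also have "\<dots> = (\<Sum>i\<le>q. of_nat (l choose i) * int_binomial z (j - int i))"
    by (rule sum.mono_neutral_right) (auto simp: int_binomial_def q)
  also have "\<dots> = (\<Sum>i=0..q. (of_nat l gchoose i) * (of_int z gchoose (q - i)))"
    by (rule sum.cong) (auto simp: int_binomial_def q binomial_gbinomial nat_diff_distrib')
  also have "\<dots> = int_binomial (z + int l) j"
    by (simp add: gbinomial_Vandermonde int_binomial_def q add.commute)
  finally show ?thesis .
qed (simp add: int_binomial_def)

text \<open>For a nonnegative exponent the expansions of \<open>(x0 + x2)^(i + j)\<close> in powers
  of either variable coincide; for a negative one they do not.\<close>

lemma int_binomial_symmetric: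
  assumes "0 \<le> i + j"
  shows "int_binomial (i + j) i = int_binomial (i + j) j"
proof -
  obtain s where s: "i + j = int s" using assms by (metis nonneg_int_cases)
  have nat_binomial: "int_binomial (int s) k = of_nat (s choose nat k)" if "0 \<le> k" for k
    using that by (simp add: int_binomial_def binomial_gbinomial)
  show ?thesis
  proof (cases "0 \<le> i \<and> 0 \<le> j")
    case True
    then have "nat j = s - nat i" "nat i \<le> s" using s by auto
    then have "s choose nat i = s choose nat j" using binomial_symmetric by metis
    with True show ?thesis by (simp add: s nat_binomial)
  next
    case False
    have "int_binomial (int s) k = 0" if "int s < k" for k
      using that nat_binomial[of k] by (simp add: binomial_eq_0)
    with False s show ?thesis
      by (cases "0 \<le> i") (auto simp: int_binomial_def)
  qed
qed

section \<open>The two expansions of \<open>a(x0 + x2) b(x2) w\<close>\<close>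

context complex_space
begin

text \<open>Taylor's formula: \<open>e^(x0 d) a(x)\<close> is \<open>a(x + x0)\<close>, expanded in
  nonnegative powers of \<open>x0\<close>.\<close>

lemma hom_divided_power_nth:
  "hom_scale scale (1 / fact n) ((hom_deriv scale ^^ n) a) v $$ p
    = scale (int_binomial (p + int n) (int n)) (a v $$ (p + int n))"
proof (induction n arbitrary: p)
  case (Suc n)
  define z where "z = (of_int (p + int (Suc n)) :: complex)"
  have IH: "(hom_deriv scale ^^ n) a v $$ p = scale (fact n * int_binomial (p + int n) (int n)) (a v $$ (p + int n))" for p
    using arg_cong[OF Suc[of p], of "scale (fact n)"] by (simp add: hom_scale_eq)
  \<comment> \<open>With \<open>z = p + n + 1\<close> one has \<open>p + 1 = z - n\<close>, and
    \<open>(z - n)\<close> times \<open>z gchoose n\<close> is \<open>(n + 1)\<close> times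
    \<open>z gchoose Suc n\<close>.\<close>
  have "(1 / fact (Suc n)) * of_int (p + 1) * fact n * (z gchoose n) = (z gchoose Suc n)"
  proof -
    have "of_int (p + 1) * (z gchoose n) = (z - of_nat n) * (z gchoose n)"
      by (simp add: z_def)
    also have "\<dots> = of_nat (Suc n) * (z gchoose Suc n)"
      using gbinomial_mult_1[of z n] by (simp add: algebra_simps)
    finally have "of_int (p + 1) * (z gchoose n) = of_nat (Suc n) * (z gchoose Suc n)" .
    then show ?thesis by (simp add: mult.assoc mult.left_commute[of _ "fact n"] del: of_nat_Suc of_int_add)
  qed
  moreover have "hom_scale scale (1 / fact (Suc n)) ((hom_deriv scale ^^ Suc n) a) v $$ p
      = scale (1 / fact (Suc n)) (scale (of_int (p + 1)) ((hom_deriv scale ^^ n) a v $$ (p + 1)))"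
    by (simp only: hom_scale_eq series.scale_scale laurent_smult_const funpow.simps comp_apply
        hom_deriv_def[of scale "(hom_deriv scale ^^ n) a"] fls_derivative_nth)
  moreover have "p + 1 + int n = p + int (Suc n)" by simp
  ultimately show ?case
    by (simp add: IH int_binomial_def z_def mult.assoc del: fact_Suc of_int_add of_nat_Suc)
qed (simp add: hom_scale_eq int_binomial_def)

text \<open>One pole order serves all coefficients of \<open>F\<close>, since they lie in the span
  of the finitely many vectors of a tensor representation. This supplies the exponent
  \<open>l\<close> for weak associativity.\<close>

lemma Hom_lower_bound:
  assumes "a \<in> Hom_laurent scale" "F \<in> tensor_laurent scale"
  obtains l :: nat where "\<And>k p. p < - int l \<Longrightarrow> a (F $$ k) $$ p = 0"
proof -
  have "\<exists>l::nat. \<forall>k p. p < - int l \<longrightarrow> a (F $$ k) $$ p = 0"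
    using assms(2)
  proof (induction rule: tensor_laurent_induct)
    case (pure f v)
    have "\<forall>k p. p < - int (nat (- fls_subdegree (a v))) \<longrightarrow> a (lsmult f (fls_const v) $$ k) $$ p = 0"
      by (auto simp: Hom_scale[OF assms(1)])
    then show ?case by blast
  next
    case (add F G)
    then obtain l l' :: nat where "\<forall>k p. p < - int l \<longrightarrow> a (F $$ k) $$ p = 0"
      "\<forall>k p. p < - int l' \<longrightarrow> a (G $$ k) $$ p = 0" by blast
    then have "\<forall>k p. p < - int (max l l') \<longrightarrow> a ((F + G) $$ k) $$ p = 0"
      by (auto simp: Hom_add[OF assms(1)])
    then show ?case by blast
  qed (simp add: Hom_0[OF assms(1)])
  then show ?thesis using that by blast
qed

text \<open>Here \<open>k = m - j\<close> is the exponent taken from \<open>b(x2) w\<close>. The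
  expansion in \<open>x2\<close> gives the lower binomial index \<open>m - k\<close>; the summation
  range depends only on \<open>n + m\<close>.\<close>

lemma composed_action_eq:
  assumes a: "a \<in> Hom_laurent scale" and l: "\<And>k p. p < - int l \<Longrightarrow> a (b w $$ k) $$ p = 0"
  shows "composed_action scale (\<lambda>a. a) a b w n m
    = (\<Sum>k=fls_subdegree (b w)..n + m + int l.
        scale (int_binomial (n + m - k) (m - k)) (a (b w $$ k) $$ (n + m - k)))"
proof -
  define N where "N = fls_subdegree (b w)"
  define t where "t k = scale (int_binomial (n + m - k) (m - k)) (a (b w $$ k) $$ (n + m - k))" for k
  have t: "subst_add scale 1 (a (b w $$ (m - int j))) n j = t (m - int j)" for j
    by (simp add: subst_add_def t_def int_binomial_def)
  have inj: "inj_on (\<lambda>k. nat (m - k)) {N..m}" by (auto simp: inj_on_def)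
  have "composed_action scale (\<lambda>a. a) a b w n m = (\<Sum>j\<in>(\<lambda>k. nat (m - k)) ` {N..m}. t (m - int j))"
    unfolding composed_action_def t
  proof (rule Sum_any.expand_superset)
    show "{j. t (m - int j) \<noteq> 0} \<subseteq> (\<lambda>k. nat (m - k)) ` {N..m}"
    proof
      fix j assume "j \<in> {j. t (m - int j) \<noteq> 0}"
      then have "b w $$ (m - int j) \<noteq> 0" by (auto simp: t_def Hom_0[OF a])
      then have "m - int j \<in> {N..m}" unfolding N_def
        using fls_subdegree_leI by auto
      then show "j \<in> (\<lambda>k. nat (m - k)) ` {N..m}" by (rule rev_image_eqI) simp
    qed
  qed simp
  also have "\<dots> = (\<Sum>k\<in>{N..m}. t k)"
    by (simp add: sum.reindex[OF inj])
  \<comment> \<open>Terms with \<open>k > m\<close> vanish through the negative lower index of the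
    binomial, and those with \<open>k > n + m + l\<close> through the pole bound, so the range can
    be exchanged via the union.\<close>
  also have "\<dots> = (\<Sum>k\<in>{N..m} \<union> {N..n + m + int l}. t k)"
    by (rule sum.mono_neutral_left) (auto simp: t_def int_binomial_def)
  also have "\<dots> = (\<Sum>k\<in>{N..n + m + int l}. t k)"
    by (rule sum.mono_neutral_right) (auto simp: t_def intro!: l)
  finally show ?thesis by (simp add: N_def t_def)
qed

text \<open>The same vectors over the same range as for \<open>composed_action\<close>, but
  \<open>a(x2 + x0)\<close> is expanded in \<open>x0\<close>, so the lower binomial index is
  \<open>n\<close>.\<close>

lemma iterated_action_eq:
  assumes a: "a \<in> Hom_laurent scale" and b: "b \<in> Hom_laurent scale"
    and l: "\<And>k p. p < - int l \<Longrightarrow> a (b w $$ k) $$ p = 0"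
  shows "iterated_action (derivation_Y (hom_scale scale) hom_mul (hom_deriv scale)) (\<lambda>a. a) a b w n m
    = (\<Sum>k=fls_subdegree (b w)..n + m + int l.
        scale (int_binomial (n + m - k) n) (a (b w $$ k) $$ (n + m - k)))"
proof (cases "n < 0")
  case True
  then show ?thesis by (simp add: iterated_action_def derivation_Y_def int_binomial_def)
next
  case False
  then obtain q where q: "n = int q" by (metis nonneg_int_cases not_less)
  define d where "d = hom_scale scale (1 / fact q) ((hom_deriv scale ^^ q) a)"
  have "(hom_deriv scale ^^ q) a \<in> Hom_laurent scale"
    by (induction q) (auto simp: a Hom_deriv)
  then have d: "d \<in> Hom_laurent scale" by (simp add: d_def Hom_hom_scale)
  have d_nth: "d (b w $$ k) $$ (m - k) = scale (int_binomial (n + m - k) n) (a (b w $$ k) $$ (n + m - k))" for k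
    unfolding d_def hom_divided_power_nth by (simp add: q algebra_simps)
  have "iterated_action (derivation_Y (hom_scale scale) hom_mul (hom_deriv scale)) (\<lambda>a. a) a b w n m
      = Sum_any (\<lambda>k. d (b w $$ k) $$ (m - k))"
    using has_extension_tensor[OF d Hom_tensor[OF b]]
    by (simp add: iterated_action_def derivation_Y_def q hom_mul_def has_extension_def has_finite_sum_def
        flip: d_def)
  also have "\<dots> = (\<Sum>k=fls_subdegree (b w)..n + m + int l. d (b w $$ k) $$ (m - k))"
  proof (rule Sum_any.expand_superset)
    show "{k. d (b w $$ k) $$ (m - k) \<noteq> 0} \<subseteq> {fls_subdegree (b w)..n + m + int l}"
    proof
      fix k assume k: "k \<in> {k. d (b w $$ k) $$ (m - k) \<noteq> 0}"
      then have "b w $$ k \<noteq> 0" by (auto simp: Hom_0[OF d])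
      then have "fls_subdegree (b w) \<le> k" by (rule fls_subdegree_leI)
      moreover have "a (b w $$ k) $$ (n + m - k) \<noteq> 0" using k by (auto simp: d_nth)
      then have "\<not> n + m - k < - int l" using l by blast
      ultimately show "k \<in> {fls_subdegree (b w)..n + m + int l}" by auto
    qed
  qed simp
  finally show ?thesis by (simp add: d_nth)
qed

text \<open>The two sides differ only in the binomials with upper index \<open>n + m - k\<close> and
  lower index \<open>m - k\<close> or \<open>n\<close>. Multiplication by \<open>(x0 + x2)^l\<close>
  makes all upper indices in the range nonnegative, where the binomials agree.\<close>

lemma weakly_associative_Hom:
  assumes a: "a \<in> Hom_laurent scale" and b: "b \<in> Hom_laurent scale"
  shows "weakly_associative scale (derivation_Y (hom_scale scale) hom_mul (hom_deriv scale)) (\<lambda>a. a) a b w"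
proof -
  obtain l where l: "\<And>k p. p < - int l \<Longrightarrow> a (b w $$ k) $$ p = 0"
    using Hom_lower_bound[OF a Hom_tensor[OF b]] by blast
  define N X where "N = fls_subdegree (b w)" and "X n m k = a (b w $$ k) $$ (n + m - int l - k)" for n m k :: int
  have composed: "composed_action scale (\<lambda>a. a) a b w n m
      = (\<Sum>k=N..n + m + int l. scale (int_binomial (n + m - k) (m - k)) (a (b w $$ k) $$ (n + m - k)))" for n m
    unfolding N_def using a l by (rule composed_action_eq)
  have iterated: "iterated_action (derivation_Y (hom_scale scale) hom_mul (hom_deriv scale)) (\<lambda>a. a) a b w n m
      = (\<Sum>k=N..n + m + int l. scale (int_binomial (n + m - k) n) (a (b w $$ k) $$ (n + m - k)))" for n m
    unfolding N_def using a b l by (rule iterated_action_eq)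
  have ind: "n - int (l - i) + (m - int i) = n + m - int l" if "i \<le> l" for n m i
    using that by simp
  have "times_binomial scale l (composed_action scale (\<lambda>a. a) a b w) n m
      = times_binomial scale l
          (iterated_action (derivation_Y (hom_scale scale) hom_mul (hom_deriv scale)) (\<lambda>a. a) a b w) n m"
    for n m
  proof -
    have "times_binomial scale l (composed_action scale (\<lambda>a. a) a b w) n m
        = (\<Sum>i\<le>l. \<Sum>k=N..n + m. scale (of_nat (l choose i) * int_binomial (n + m - int l - k) (m - k - int i)) (X n m k))"
      unfolding times_binomial_def
      by (rule sum.cong[OF refl]) (simp add: composed ind scale_sum_right N_def X_def
          algebra_simps)
    also have "\<dots> = (\<Sum>k=N..n + m. scale (\<Sum>i\<le>l. of_nat (l choose i) * int_binomial (n + m - int l - k) (m - k - int i)) (X n m k))"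
      by (subst sum.swap) (simp add: scale_sum_left)
    \<comment> \<open>Vandermonde raises the upper index \<open>n + m - l - k\<close> by
      \<open>l\<close>. It is now nonnegative for all \<open>k \<le> n + m\<close>, so symmetry
      applies next, and Vandermonde is then undone with lower index \<open>n\<close>.\<close>
    also have "\<dots> = (\<Sum>k=N..n + m. scale (int_binomial (n + (m - k)) (m - k)) (X n m k))"
      by (simp only: int_binomial_Vandermonde) (simp add: algebra_simps)
    also have "\<dots> = (\<Sum>k=N..n + m. scale (int_binomial (n + (m - k)) n) (X n m k))"
      by (intro sum.cong refl arg_cong2[of _ _ _ _ scale] int_binomial_symmetric[symmetric]) auto
    also have "\<dots> = (\<Sum>k=N..n + m. scale (\<Sum>i\<le>l. of_nat (l choose i) * int_binomial (n + m - int l - k) (n - int i)) (X n m k))"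
      by (simp only: int_binomial_Vandermonde) (simp add: algebra_simps)
    also have "\<dots> = (\<Sum>i\<le>l. \<Sum>k=N..n + m. scale (of_nat (l choose i) * int_binomial (n + m - int l - k) (n - int i)) (X n m k))"
      by (subst sum.swap) (simp add: scale_sum_left)
    \<comment> \<open>The order of summation is reversed because \<open>times_binomial\<close>
      lowers the \<open>x0\<close> exponent by \<open>l - i\<close>, not by
      \<open>i\<close>.\<close>
    also have "\<dots> = (\<Sum>i\<le>l. \<Sum>k=N..n + m. scale (of_nat (l choose (l - i)) * int_binomial (n + m - int l - k) (n - int (l - i))) (X n m k))"
      unfolding atLeast0AtMost[symmetric] by (subst sum.atLeastAtMost_rev) simp
    also have "\<dots> = times_binomial scale l
          (iterated_action (derivation_Y (hom_scale scale) hom_mul (hom_deriv scale)) (\<lambda>a. a) a b w) n m"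
      unfolding times_binomial_def
    proof (rule sum.cong[OF refl])
      fix i assume "i \<in> {..l}"
      then have i: "i \<le> l" by simp
      show "(\<Sum>k=N..n + m. scale (of_nat (l choose (l - i)) * int_binomial (n + m - int l - k) (n - int (l - i))) (X n m k))
        = scale (of_nat (l choose i)) (iterated_action (derivation_Y (hom_scale scale) hom_mul (hom_deriv scale))
            (\<lambda>a. a) a b w (n - int (l - i)) (m - int i))"
        unfolding iterated ind[OF i] scale_sum_right scale_scale
          binomial_symmetric[OF i, symmetric]
        by (simp add: N_def X_def)
    qed
    finally show ?thesis .
  qed
  then show ?thesis unfolding weakly_associative_def by blast
qed

end

theorem proposition3p4:
  fixes s :: "complex \<Rightarrow> 'v::ab_group_add \<Rightarrow> 'v"
    and Y :: "'v \<Rightarrow> 'v \<Rightarrow> 'v fls"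
    and vac :: 'v
  assumes "nonlocal_vertex_algebra s UNIV Y vac"
  shows "Delta_closed s Y (B_space s Y vac)
    \<and> unital_subalgebra (hom_scale s) (Hom_laurent s) hom_mul hom_one (B_space s Y vac)
    \<and> algebra_derivation (hom_scale s) (Hom_laurent s) hom_mul hom_one (hom_deriv s)
    \<and> (\<forall>a\<in>B_space s Y vac. hom_deriv s a \<in> B_space s Y vac)
    \<and> nonlocal_vertex_algebra (hom_scale s) (B_space s Y vac)
        (derivation_Y (hom_scale s) hom_mul (hom_deriv s)) hom_one
    \<and> nonlocal_vertex_algebra_module (hom_scale s) (B_space s Y vac)
        (derivation_Y (hom_scale s) hom_mul (hom_deriv s)) hom_one s UNIV (\<lambda>a. a)"
proof -
  interpret V: nonlocal_vertex_algebra s UNIV Y vac by (rule assms)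
  \<comment> \<open>The carrier is the whole type, so the bilinearity axioms hold
    unconditionally.\<close>
  interpret bilinear_operators s Y
    by unfold_locales (simp_all add: V.Y_add_left V.Y_scale_left V.Y_add_right V.Y_scale_right)
  interpret D: algebra_derivation "hom_scale s" "Hom_laurent s" hom_mul hom_one "hom_deriv s"
    by (rule algebra_derivation_Hom)
  interpret N: nonlocal_vertex_algebra "hom_scale s" "B_space s Y vac"
      "derivation_Y (hom_scale s) hom_mul (hom_deriv s)" hom_one
    by (rule algebra_derivation.nonlocal_vertex_algebra_derivation_Y[OF algebra_derivation_B_space])
  have Hom: "a \<in> B_space s Y vac \<Longrightarrow> a \<in> Hom_laurent s" for a
    using B_space_subset by blast
  have "unital_subalgebra (hom_scale s) (Hom_laurent s) hom_mul hom_one (B_space s Y vac)"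
    by unfold_locales (simp_all add: B_space_subset B_space_subspace B_space_one B_space_mul)
  \<comment> \<open>Weak associativity was shown for all pairs in \<open>Hom_laurent\<close>, hence
    holds for pairs in B(V).\<close>
  moreover have "nonlocal_vertex_algebra_module (hom_scale s) (B_space s Y vac)
      (derivation_Y (hom_scale s) hom_mul (hom_deriv s)) hom_one s UNIV (\<lambda>a. a)"
    by unfold_locales
      (auto simp: Hom Hom_add Hom_scale hom_scale_def fls_scale_eq hom_one_def weakly_associative_Hom)
  ultimately show ?thesis
    by (simp add: B_space_Delta_closed B_space_deriv D.algebra_derivation_axioms
        N.nonlocal_vertex_algebra_axioms)
qed

end
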